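(* For a class $\mathcal C$ of graphs, the following are equivalent: (1) $\mathcal C$ has bounded clique-width; (2) $\sup_{G\in\mathcal C}\mathrm{mw}_\infty(G)<\infty$; (3) $\sup_{G\in\mathcal C}\mathrm{tmw}_\infty(G)<\infty$; (4) $\sup_{G\in\mathcal C}\mathrm{pmw}_\infty(G)<\infty$; (5) $\sup_{G\in\mathcal C}\mathrm{dmw}_\infty(G)<\infty$.
   Context: All graphs are finite, simple and undirected. For a partition $\mathcal P$ of $V(G)$ and $X\subseteq V(G)$, $X/\mathcal P$ denotes the set of parts of $\mathcal P$ that intersect $X$. For a set $R\subseteq\binom{V(G)}{2}$, $\mathrm{Ball}^r_R(v)$ is the set of vertices at distance at most $r$ from $v$ in $(V(G),R)$; similarly $\mathrm{Ball}^r_H(v)$ for a graph $H$. A partition $\mathcal P$ is homogeneous modulo $R$ if for all parts $X,Y\in\mathcal P$ (possibly equal), the pairs $\{x,y\}$ with $x\in X,y\in Y,x\ne y,\{x,y\}\notin R$ are all edges of $G$ or all non-edges. A merge sequence for $G$ is $(\mathcal P_1,R_1),\dots,(\mathcal P_m,R_m)$ with $\mathcal P_1\preceq\dots\preceq\mathcal P_m$ partitions of $V(G)$ (each coarser than or equal to the previous), $\mathcal P_1$ into singletons, $\mathcal P_m=\{V(G)\}$, $R_1\subseteq\dots\subseteq R_m\subseteq\binom{V(G)}2$, $\mathcal P_t$ homogeneous modulo $R_t$. Its radius-$r$ width is $\max_{1\le t<m}\max_v|\mathrm{Ball}^r_{R_{t+1}}(v)/\mathcal P_t|$; $\mathrm{mw}_r(G)$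 is its minimum. A $\mathcal P$-flip of $G$ is obtained by complementing adjacency between all pairs of distinct vertices of $X\times Y$ for some chosen pairs $(X,Y)$ of parts of $\mathcal P$ (possibly $X=Y$). $\mathrm{dist}_{\mathcal P}(x,y)=\max$ of $\mathrm{dist}_{G'}(x,y)$ over all $\mathcal P$-flips $G'$; $\mathrm{Ball}^r_{\mathcal P}(v)$ accordingly. $\mathcal N_S$ is the partition into atomic types over $S$: elements of $S$ are singletons and $u,v\notin S$ are in the same part iff $N(u)\cap S=N(v)\cap S$. $\mathrm{tmw}_r(G)$: least $k$ such that there is $(\mathcal P_1,G_1),\dots,(\mathcal P_m,G_m)$ with $\mathcal P_1\preceq\dots\preceq\mathcal P_m$ from singletons to $\{V(G)\}$, $G_i$ a $\mathcal P_i$-flip of $G$, and $|\mathrm{Ball}^r_{G_{i+1}}(v)/\mathcal P_i|\le k$ for all $i<m$, $v$. $\mathrm{pmw}_r(G)$: minimum over chains $\mathcal P_1\preceq\dots\preceq\mathcal P_m$ from singletons to $\{V(G)\}$ of $\max_{i<m}\max_v|\mathrm{Ball}^r_{\mathcal P_{i+1}}(v)/\mathcal P_i|$. $\mathrm{dmw}_r(G)$: minimum over total orders $v_1<\dots<v_n$ of $V(G)$ of $\max_{1\le i\le n}\max_v|\mathrm{Ball}^r_{\mathcal P_i}(v)/\mathcal P_i|$, where $\mathcal P_i=\mathcal N_{\{v_1,\dots,v_{n-i}\}}$. The radius-$\infty$ versions $\mathrm{mw}_\infty,\mathrm{tmw}_\infty,\mathrm{pmw}_\infty,\mathrm{dmw}_\infty$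 are defined identically but with $\mathrm{Ball}^\infty(v)=\bigcup_{r\ge1}\mathrm{Ball}^r(v)$ in place of $\mathrm{Ball}^r(v)$ (equivalently, taking $r\ge|V(G)|-1$). *)

theory Defs
  imports Main "HOL-Library.Extended_Nat" "HOL-Library.Disjoint_Sets" "HOL-Library.Ramsey"
begin

record 'a ugraph =
  verts :: "'a set"
  edges :: "'a set set"

definition simple_graph :: "'a ugraph \<Rightarrow> bool" where
  "simple_graph G \<longleftrightarrow> finite (verts G) \<and> edges G \<subseteq> [verts G]\<^bsup>2\<^esup>"

definition nbhd :: "'a ugraph \<Rightarrow> 'a \<Rightarrow> 'a set" where
  "nbhd G v = {u. {u, v} \<in> edges G}"

definition gdist :: "'a ugraph \<Rightarrow> 'a \<Rightarrow> 'a \<Rightarrow> enat" where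
  "gdist G x y = Inf {enat n |n. (x, y) \<in> {(u, w). {u, w} \<in> edges G} ^^ n}"

text \<open>
  The radius \<open>r\<close> may be \<open>\<infinity>\<close>. The ball of radius \<open>\<infinity>\<close> is the union of all balls of finite
  radius, so it does not contain the points at distance \<open>\<infinity>\<close>.
\<close>

definition ball_of :: "'a set \<Rightarrow> ('a \<Rightarrow> 'a \<Rightarrow> enat) \<Rightarrow> enat \<Rightarrow> 'a \<Rightarrow> 'a set" where
  "ball_of V d r v =
     (case r of
        enat n \<Rightarrow> {u \<in> V. d v u \<le> enat n}
      | \<infinity> \<Rightarrow> (\<Union>n\<in>{1::nat..}. {u \<in> V. d v u \<le> enat n}))"

definition graph_ball :: "'a ugraph \<Rightarrow> enat \<Rightarrow> 'a \<Rightarrow> 'a set" where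
  "graph_ball G = ball_of (verts G) (gdist G)"

definition parts_meeting :: "'a set \<Rightarrow> 'a set set \<Rightarrow> 'a set set" where
  "parts_meeting X P = {A \<in> P. A \<inter> X \<noteq> {}}"

text \<open>
  The one-part partition is written \<open>{V} - {{}}\<close> so that the graph without vertices, whose only
  partition is the empty one, is covered as well. All width parameters below are then \<open>0\<close> on it.
\<close>

definition partition_chain :: "'a set \<Rightarrow> nat \<Rightarrow> (nat \<Rightarrow> 'a set set) \<Rightarrow> bool" where
  "partition_chain V m P \<longleftrightarrow>
     1 \<le> m \<and>
     (\<forall>t\<in>{1..m}. partition_on V (P t)) \<and>
     (\<forall>t\<in>{1..<m}. refines V (P t) (P (t + 1))) \<and>
     P 1 = (\<lambda>v. {v}) ` V \<and>
     P m = {V} - {{}}"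

definition homogeneous_mod :: "'a ugraph \<Rightarrow> 'a set set \<Rightarrow> 'a set set \<Rightarrow> bool" where
  "homogeneous_mod G P R \<longleftrightarrow>
     (\<forall>X\<in>P. \<forall>Y\<in>P.
        (\<forall>x\<in>X. \<forall>y\<in>Y. x \<noteq> y \<and> {x, y} \<notin> R \<longrightarrow> {x, y} \<in> edges G) \<or>
        (\<forall>x\<in>X. \<forall>y\<in>Y. x \<noteq> y \<and> {x, y} \<notin> R \<longrightarrow> {x, y} \<notin> edges G))"

definition merge_sequence ::
    "'a ugraph \<Rightarrow> nat \<Rightarrow> (nat \<Rightarrow> 'a set set) \<Rightarrow> (nat \<Rightarrow> 'a set set) \<Rightarrow> bool" where
  "merge_sequence G m P R \<longleftrightarrow>
     partition_chain (verts G) m P \<and>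
     (\<forall>t\<in>{1..<m}. R t \<subseteq> R (t + 1)) \<and>
     (\<forall>t\<in>{1..m}. R t \<subseteq> [verts G]\<^bsup>2\<^esup> \<and> homogeneous_mod G (P t) (R t))"

definition merge_sequence_width ::
    "enat \<Rightarrow> 'a ugraph \<Rightarrow> nat \<Rightarrow> (nat \<Rightarrow> 'a set set) \<Rightarrow> (nat \<Rightarrow> 'a set set) \<Rightarrow> enat" where
  "merge_sequence_width r G m P R =
     (SUP t\<in>{1..<m}. SUP v\<in>verts G.
        enat (card (parts_meeting (graph_ball \<lparr>verts = verts G, edges = R (t + 1)\<rparr> r v) (P t))))"

definition mw :: "enat \<Rightarrow> 'a ugraph \<Rightarrow> enat" where
  "mw r G = Inf {merge_sequence_width r G m P R |m P R. merge_sequence G m P R}"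

definition flip_by :: "'a ugraph \<Rightarrow> ('a set \<times> 'a set) set \<Rightarrow> 'a ugraph" where
  "flip_by G F =
     \<lparr>verts = verts G,
      edges = sym_diff (edges G) {{x, y} |x y. x \<noteq> y \<and> (\<exists>(X, Y)\<in>F. x \<in> X \<and> y \<in> Y)}\<rparr>"

definition flips :: "'a ugraph \<Rightarrow> 'a set set \<Rightarrow> 'a ugraph set" where
  "flips G P = {flip_by G F |F. F \<subseteq> P \<times> P}"

definition flip_dist :: "'a ugraph \<Rightarrow> 'a set set \<Rightarrow> 'a \<Rightarrow> 'a \<Rightarrow> enat" where
  "flip_dist G P x y = (SUP G'\<in>flips G P. gdist G' x y)"

definition flip_ball :: "'a ugraph \<Rightarrow> 'a set set \<Rightarrow> enat \<Rightarrow> 'a \<Rightarrow> 'a set" where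
  "flip_ball G P = ball_of (verts G) (flip_dist G P)"

definition tmw :: "enat \<Rightarrow> 'a ugraph \<Rightarrow> enat" where
  "tmw r G = Inf {enat k |k. \<exists>m P H.
     partition_chain (verts G) m P \<and>
     (\<forall>i\<in>{1..m}. H i \<in> flips G (P i)) \<and>
     (\<forall>i\<in>{1..<m}. \<forall>v\<in>verts G. card (parts_meeting (graph_ball (H (i + 1)) r v) (P i)) \<le> k)}"

definition pmw :: "enat \<Rightarrow> 'a ugraph \<Rightarrow> enat" where
  "pmw r G = Inf {SUP i\<in>{1..<m}. SUP v\<in>verts G.
                    enat (card (parts_meeting (flip_ball G (P (i + 1)) r v) (P i)))
                  |m P. partition_chain (verts G) m P}"

definition atomic_type_partition :: "'a ugraph \<Rightarrow> 'a set \<Rightarrow> 'a set set" where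
  "atomic_type_partition G S =
     (\<lambda>s. {s}) ` S \<union>
     (verts G - S) // {(u, v). u \<in> verts G - S \<and> v \<in> verts G - S \<and> nbhd G u \<inter> S = nbhd G v \<inter> S}"

text \<open>A total order of the vertex set is given by the list of the vertices in increasing order.\<close>

definition dmw :: "enat \<Rightarrow> 'a ugraph \<Rightarrow> enat" where
  "dmw r G =
     Inf {SUP i\<in>{1..length vs}. SUP v\<in>verts G.
            (let P = atomic_type_partition G (set (take (length vs - i) vs))
             in enat (card (parts_meeting (flip_ball G P r v) P)))
          |vs. distinct vs \<and> set vs = verts G}"

text \<open>
  The labelled graphs denoted by \<open>k\<close>-expressions, with labels \<open>0, \<dots>, k - 1\<close>. Only the values of
  the labelling on the vertex set matter. Vertices keep their names, so that no closure under
  isomorphism is needed.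
\<close>

inductive cw_constructible :: "nat \<Rightarrow> 'a ugraph \<Rightarrow> ('a \<Rightarrow> nat) \<Rightarrow> bool" for k where
  vertex: "l v < k \<Longrightarrow> cw_constructible k \<lparr>verts = {v}, edges = {}\<rparr> l"
| disjoint_union:
    "cw_constructible k G l \<Longrightarrow> cw_constructible k H l' \<Longrightarrow> verts G \<inter> verts H = {} \<Longrightarrow>
     cw_constructible k \<lparr>verts = verts G \<union> verts H, edges = edges G \<union> edges H\<rparr>
       (\<lambda>v. if v \<in> verts G then l v else l' v)"
| join:
    "cw_constructible k G l \<Longrightarrow> i < k \<Longrightarrow> j < k \<Longrightarrow> i \<noteq> j \<Longrightarrow>
     cw_constructible k
       \<lparr>verts = verts G,
        edges = edges G \<union> {{x, y} |x y. x \<in> verts G \<and> y \<in> verts G \<and> l x = i \<and> l y = j}\<rparr> l"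
| relabel:
    "cw_constructible k G l \<Longrightarrow> i < k \<Longrightarrow> j < k \<Longrightarrow>
     cw_constructible k G (\<lambda>v. if l v = i then j else l v)"

text \<open>No \<open>k\<close>-expression denotes the graph without vertices; its clique-width is \<open>0\<close> by convention.\<close>

definition clique_width :: "'a ugraph \<Rightarrow> enat" where
  "clique_width G = Inf {enat k |k. verts G = {} \<or> (\<exists>l. cw_constructible k G l)}"

end

theory Submission
  imports Defs
begin

text \<open>
  From a chain of partitions to clique-width: call two vertices inseparable at time \<open>t\<close> if they are
  connected in the red graph \<open>R\<^sub>t\<close>, respectively in every flip by the \<open>t\<close>-th partition. Any
  vertex set with a separable pair splits into two sets whose mutual adjacency depends only on the
  parts, and any set without one meets at most \<open>k\<close> parts of the previous partition. Recursively
  this yields an expression with \<open>2k\<close> labels.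

  Conversely, an expression with \<open>k\<close> labels gives a binary laminar family of vertex sets, each having
  at most \<open>k\<close> neighbourhoods towards its complement. The maximal members of size at most
  \<open>t\<close>, refined by external neighbourhoods, form a merge sequence, and flipping away the edges
  between different members gives the flips.

  For the vertex order, the graph is kept partitioned into pieces \<open>X - Y\<close> with \<open>X\<close>, \<open>Y\<close> in the
  family, each containing boundedly many vertices of the current prefix \<open>S\<close>, chosen such that
  some flip by the atomic types over \<open>S\<close> has no edges between different pieces. That boundedly many
  vertices suffice is a duality for two vertex sets \<open>U\<close>, \<open>W\<close>: a bounded set \<open>S\<close> can be chosen
  such that no \<open>u \<in> U\<close> is complete to \<open>S \<inter> W\<close> or no \<open>v \<in> W\<close> is anticomplete to \<open>S \<inter> U\<close>.
\<close>

subsection \<open>Balls of infinite radius\<close>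

text \<open>Only the vertex order is hard. Partitions and flips may follow the laminar family,
  whereas the atomic types over a prefix \<open>S\<close> are forced, and one type may occur in
  several pieces. A flip must treat a pair of types alike wherever it occurs. Representatives in
  \<open>S\<close> of the external neighbourhoods of each piece let one end of an edge be exchanged
  within its type as long as it stays outside the piece of the other end; the only case not reached
  by such moves is the one where the two ends trade pieces, and the duality is what excludes it.
  Enlarging \<open>S\<close> keeps these properties but raises the number of types, so a piece that
  receives a vertex is broken up until each part holds at most one old vertex, and then gets new
  representatives. Laminar members with at most one member removed are closed under this and still
  have at most \<open>k * 2 ^ k\<close> external neighbourhoods. The doubling to \<open>2k\<close>
  labels comes from a spare copy of the labels, which keeps two vertex sets apart while they are
  joined.\<close>

abbreviation adj_rel :: "'a ugraph \<Rightarrow> ('a \<times> 'a) set" where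
  "adj_rel G \<equiv> {(u, w). {u, w} \<in> edges G}"

lemma gdist_le_imp_reachable:
  assumes "gdist G x y \<le> enat n"
  shows "(x, y) \<in> (adj_rel G)\<^sup>*"
proof -
  have "{enat n |n. (x, y) \<in> adj_rel G ^^ n} \<noteq> {}"
    using assms unfolding gdist_def by (metis Inf_empty infinity_ileE top_enat_def)
  then show ?thesis
    by (auto intro: relpow_imp_rtrancl)
qed

lemma reachable_imp_gdist_le:
  assumes "(x, y) \<in> (adj_rel G)\<^sup>*"
  shows "\<exists>n. gdist G x y \<le> enat n"
proof -
  obtain n where "(x, y) \<in> adj_rel G ^^ n"
    using assms by (auto simp: rtrancl_power)
  then have "gdist G x y \<le> enat n"
    unfolding gdist_def by (intro Inf_lower) auto
  then show ?thesis ..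
qed

lemma ball_of_infinity: "ball_of V d \<infinity> v = {u \<in> V. \<exists>n. d v u \<le> enat n}"
proof -
  have "\<exists>m\<in>{1..}. d v u \<le> enat m" if "d v u \<le> enat n" for u n
    by (rule bexI[of _ "Suc n"]) (auto intro: order_trans[OF that])
  then have "(\<exists>m\<in>{1..}. d v u \<le> enat m) \<longleftrightarrow> (\<exists>n. d v u \<le> enat n)" for u
    by blast
  then show ?thesis
    unfolding ball_of_def by auto
qed

lemma graph_ball_infinity: "graph_ball G \<infinity> v = {u \<in> verts G. (v, u) \<in> (adj_rel G)\<^sup>*}"
  unfolding graph_ball_def ball_of_infinity
  by (intro Collect_cong conj_cong refl iffI)
    (blast intro: gdist_le_imp_reachable, rule reachable_imp_gdist_le)

text \<open>Finiteness of \<open>P\<close> matters: there are then finitely many flips, and a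
  maximum of finitely many finite distances is finite, so the ball is the intersection of the
  components of \<open>v\<close> over all flips.\<close>

lemma flip_ball_infinity:
  assumes "finite P"
  shows "flip_ball G P \<infinity> v = {u \<in> verts G. \<forall>H\<in>flips G P. (v, u) \<in> (adj_rel H)\<^sup>*}"
proof -
  have fin: "finite (flips G P)"
  proof -
    have "flips G P = flip_by G ` Pow (P \<times> P)"
      unfolding flips_def by blast
    then show ?thesis
      using assms by simp
  qed
  have "(\<exists>n. flip_dist G P v u \<le> enat n) \<longleftrightarrow> (\<forall>H\<in>flips G P. (v, u) \<in> (adj_rel H)\<^sup>*)" for u
  proof
    assume "\<exists>n. flip_dist G P v u \<le> enat n"
    then obtain n where n: "flip_dist G P v u \<le> enat n" ..
    show "\<forall>H\<in>flips G P. (v, u) \<in> (adj_rel H)\<^sup>*"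
    proof
      fix H assume "H \<in> flips G P"
      then have "gdist H v u \<le> enat n"
        unfolding flip_dist_def by (rule order_trans[OF SUP_upper n[unfolded flip_dist_def]])
      then show "(v, u) \<in> (adj_rel H)\<^sup>*"
        by (rule gdist_le_imp_reachable)
    qed
  next
    assume "\<forall>H\<in>flips G P. (v, u) \<in> (adj_rel H)\<^sup>*"
    then have "\<forall>H\<in>flips G P. \<exists>n. gdist H v u \<le> enat n"
      by (simp add: reachable_imp_gdist_le)
    from bchoice[OF this] obtain f where f: "\<And>H. H \<in> flips G P \<Longrightarrow> gdist H v u \<le> enat (f H)"
      by blast
    \<comment> \<open>The sum is a common bound for the finitely many distances, in place of their
      maximum.\<close>
    have "gdist H v u \<le> enat (\<Sum>H\<in>flips G P. f H)" if "H \<in> flips G P" for H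
    proof -
      have "f H \<le> (\<Sum>H\<in>flips G P. f H)"
        using that fin by (intro member_le_sum) auto
      then show ?thesis
        using f[OF that] by (meson enat_ord_simps(1) order_trans)
    qed
    then have "flip_dist G P v u \<le> enat (\<Sum>H\<in>flips G P. f H)"
      unfolding flip_dist_def by (rule SUP_least)
    then show "\<exists>n. flip_dist G P v u \<le> enat n" ..
  qed
  then show ?thesis
    unfolding flip_ball_def ball_of_infinity by simp
qed

lemma flip_ball_subset_graph_ball:
  assumes "H \<in> flips G P" "finite P"
  shows "flip_ball G P \<infinity> v \<subseteq> graph_ball H \<infinity> v"
  using assms unfolding flip_ball_infinity[OF assms(2)] graph_ball_infinity
  by (auto simp: flips_def flip_by_def)

lemma reachable_monochromatic:
  assumes "\<And>x y. {x, y} \<in> edges H \<Longrightarrow> c x = c y" "(v, u) \<in> (adj_rel H)\<^sup>*"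
  shows "c u = c v"
  using assms(2)
proof induction
  case (step y z)
  then have "{y, z} \<in> edges H"
    by simp
  from assms(1)[OF this] step.IH show ?case
    by simp
qed simp

lemma graph_ball_monochromatic:
  assumes "\<And>x y. {x, y} \<in> edges H \<Longrightarrow> c x = c y"
  shows "graph_ball H \<infinity> v \<subseteq> {u \<in> verts H. c u = c v}"
proof
  fix u assume "u \<in> graph_ball H \<infinity> v"
  then have "u \<in> verts H" "(v, u) \<in> (adj_rel H)\<^sup>*"
    by (auto simp: graph_ball_infinity)
  then show "u \<in> {u \<in> verts H. c u = c v}"
    using reachable_monochromatic[of H c v u, OF assms] by blast
qed

subsection \<open>Partitions into the fibres of a function\<close>

lemma partition_on_disjointD:
  assumes "partition_on A P" "X \<in> P" "Y \<in> P" "x \<in> X" "x \<in> Y"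
  shows "X = Y"
  using assms by (auto simp: partition_on_def disjoint_def)

lemma parts_meeting_mono:
  assumes "X \<subseteq> Y"
  shows "parts_meeting X P \<subseteq> parts_meeting Y P"
  using assms by (auto simp: parts_meeting_def)

lemma card_parts_meeting_mono:
  assumes "X \<subseteq> Y" "finite P"
  shows "card (parts_meeting X P) \<le> card (parts_meeting Y P)"
  using parts_meeting_mono[OF assms(1)] assms(2)
  by (intro card_mono) (auto simp: parts_meeting_def)

lemma card_image_le_factor:
  assumes "finite X" "\<And>x y. x \<in> X \<Longrightarrow> y \<in> X \<Longrightarrow> g x = g y \<Longrightarrow> f x = f y"
  shows "card (f ` X) \<le> card (g ` X)"
proof (rule surj_card_le)
  show "f ` X \<subseteq> (\<lambda>p. f (inv_into X g p)) ` g ` X"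
  proof
    fix a assume "a \<in> f ` X"
    then obtain x where x: "x \<in> X" "a = f x"
      by blast
    have "f (inv_into X g (g x)) = f x"
      by (rule assms(2)) (auto simp: inv_into_into f_inv_into_f x)
    then show "a \<in> (\<lambda>p. f (inv_into X g p)) ` g ` X"
      using x by force
  qed
qed (use assms in simp)

text \<open>Partitions are handled through a labelling function: refinement becomes factorisation of
  functions, and counting the parts met by a set becomes counting values.\<close>

definition fibres :: "'a set \<Rightarrow> ('a \<Rightarrow> 'b) \<Rightarrow> 'a set set" where
  "fibres V h = (\<lambda>x. {y \<in> V. h y = h x}) ` V"

lemma partition_on_fibres: "partition_on V (fibres V h)"
  by (rule partition_onI) (auto simp: fibres_def disjnt_def)

lemma refines_fibres:
  assumes "\<And>x y. x \<in> V \<Longrightarrow> y \<in> V \<Longrightarrow> h x = h y \<Longrightarrow> g x = g y"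
  shows "refines V (fibres V h) (fibres V g)"
  unfolding refines_def
proof (intro conjI partition_on_fibres ballI)
  fix X assume "X \<in> fibres V h"
  then obtain x where "x \<in> V" "X = {y \<in> V. h y = h x}"
    by (auto simp: fibres_def)
  then have "X \<subseteq> {y \<in> V. g y = g x}"
    using assms[of _ x] by blast
  then show "\<exists>Y\<in>fibres V g. X \<subseteq> Y"
    using \<open>x \<in> V\<close> unfolding fibres_def by blast
qed

lemma fibres_inj_on: "inj_on h V \<Longrightarrow> fibres V h = (\<lambda>v. {v}) ` V"
  unfolding fibres_def by (intro image_cong refl) (auto dest: inj_onD)

lemma fibres_const:
  assumes "\<And>x y. x \<in> V \<Longrightarrow> y \<in> V \<Longrightarrow> h x = h y"
  shows "fibres V h = {V} - {{}}"
proof -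
  have "{y \<in> V. h y = h x} = V" if "x \<in> V" for x
    using assms that by blast
  then show ?thesis
    unfolding fibres_def by (cases "V = {}") auto
qed

lemma card_parts_meeting_fibres:
  assumes "X \<subseteq> V" "finite V"
  shows "card (parts_meeting X (fibres V h)) = card (h ` X)"
proof -
  have "parts_meeting X (fibres V h) = (\<lambda>c. {y \<in> V. h y = c}) ` h ` X"
  proof (intro set_eqI iffI)
    fix A assume "A \<in> parts_meeting X (fibres V h)"
    then obtain x z where "A = {y \<in> V. h y = h x}" "z \<in> A" "z \<in> X"
      unfolding parts_meeting_def fibres_def by auto
    then have "A = {y \<in> V. h y = h z}"
      by auto
    then show "A \<in> (\<lambda>c. {y \<in> V. h y = c}) ` h ` X"
      using \<open>z \<in> X\<close> by blast
  next
    fix A assume "A \<in> (\<lambda>c. {y \<in> V. h y = c}) ` h ` X"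
    then obtain x where "x \<in> X" "A = {y \<in> V. h y = h x}"
      by auto
    then show "A \<in> parts_meeting X (fibres V h)"
      using assms(1) unfolding parts_meeting_def fibres_def by auto
  qed
  moreover have "inj_on (\<lambda>c. {y \<in> V. h y = c}) (h ` X)"
  proof (rule inj_onI)
    fix c d assume "c \<in> h ` X" "{y \<in> V. h y = c} = {y \<in> V. h y = d}"
    then show "c = d"
      using assms(1) by blast
  qed
  ultimately show ?thesis
    by (simp add: card_image)
qed

subsection \<open>Flips that remove all edges between colour classes\<close>

lemma simple_graph_edge:
  assumes "simple_graph G" "{x, y} \<in> edges G"
  shows "x \<in> verts G" "y \<in> verts G" "x \<noteq> y"
proof -
  have "{x, y} \<in> [verts G]\<^bsup>2\<^esup>"
    using assms unfolding simple_graph_def by blast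
  then show "x \<in> verts G" "y \<in> verts G" "x \<noteq> y"
    unfolding doubleton_in_nsets_2 by blast+
qed

text \<open>The colouring \<open>c\<close> need not be constant on the fibres of \<open>h\<close>;
  \<open>hom\<close> only asks that adjacency between differently coloured vertices depends on the
  values of \<open>h\<close>. Complementing the pairs of fibres that contain a two-coloured edge
  removes all two-coloured edges and creates none; pairs of equal colour may change freely.\<close>

lemma flip_separating_colours:
  assumes G: "simple_graph G"
    and hom: "\<And>x x' y y'. \<lbrakk>x \<in> verts G; x' \<in> verts G; y \<in> verts G; y' \<in> verts G;
      h x = h x'; h y = h y'; c x \<noteq> c y; c x' \<noteq> c y'; {x, y} \<in> edges G\<rbrakk> \<Longrightarrow> {x', y'} \<in> edges G"
  obtains H where "H \<in> flips G (fibres (verts G) h)"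
    "\<And>x y. {x, y} \<in> edges H \<Longrightarrow> c x = c y"
proof -
  define P where "P = fibres (verts G) h"
  define F where "F = {(A, B) \<in> P \<times> P. \<exists>a\<in>A. \<exists>b\<in>B. c a \<noteq> c b \<and> {a, b} \<in> edges G}"
  have P: "x \<in> verts G" "h x = h y" if "A \<in> P" "x \<in> A" "y \<in> A" for A x y
    using that unfolding P_def fibres_def by auto
  have F: "{a, b} \<in> edges G"
    if AB: "(A, B) \<in> F" "a \<in> A" "b \<in> B" "c a \<noteq> c b" for A B a b
  proof -
    obtain a' b' where "a' \<in> A" "b' \<in> B" "c a' \<noteq> c b'" "{a', b'} \<in> edges G" "A \<in> P" "B \<in> P"
      using AB(1) unfolding F_def by blast
    then show ?thesis
      using hom[of a' a b' b] P AB by metis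
  qed
  have "c x = c y" if e: "{x, y} \<in> edges (flip_by G F)" for x y
  proof (rule ccontr)
    assume ne: "c x \<noteq> c y"
    let ?D = "{{x, y} |x y. x \<noteq> y \<and> (\<exists>(X, Y)\<in>F. x \<in> X \<and> y \<in> Y)}"
    have sd: "{x, y} \<in> edges G \<longleftrightarrow> {x, y} \<notin> ?D"
      using e unfolding flip_by_def ugraph.simps Un_iff Diff_iff by blast
    show False
    proof (cases "{x, y} \<in> edges G")
      case True
      define A where "A = {z \<in> verts G. h z = h x}"
      define B where "B = {z \<in> verts G. h z = h y}"
      have xy: "x \<in> verts G" "y \<in> verts G" "x \<noteq> y"
        using simple_graph_edge[OF G True] by auto
      then have "A \<in> P" "B \<in> P" "x \<in> A" "y \<in> B"
        unfolding A_def B_def P_def fibres_def by auto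
      then have "(A, B) \<in> F"
        using True ne unfolding F_def by blast
      then have "{x, y} \<in> ?D"
        using \<open>x \<in> A\<close> \<open>y \<in> B\<close> xy by blast
      then show False
        using sd True by simp
    next
      case False
      then have "{x, y} \<in> ?D"
        using sd by simp
      then obtain a b A B where "{x, y} = {a, b}" "(A, B) \<in> F" "a \<in> A" "b \<in> B"
        by auto
      moreover from this have "c a \<noteq> c b"
        using ne by (auto simp: doubleton_eq_iff)
      ultimately show False
        using F False by metis
    qed
  qed
  moreover have "flip_by G F \<in> flips G P"
    unfolding flips_def F_def by auto
  ultimately show ?thesis
    using that unfolding P_def by blast
qed

subsection \<open>Building labelled graphs\<close>

text \<open>
  A relabelling step also acts on the labels of points outside the graph, so
  \<open>cw_constructible\<close> is not invariant under changing the labelling there; the closure of the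
  predicate under such changes is.
\<close>

definition cw_labelled :: "nat \<Rightarrow> 'a ugraph \<Rightarrow> ('a \<Rightarrow> nat) \<Rightarrow> bool" where
  "cw_labelled k G l \<longleftrightarrow> (\<exists>l'. cw_constructible k G l' \<and> (\<forall>v\<in>verts G. l' v = l v))"

lemma cw_labelled_cong:
  assumes "cw_labelled k G l" "\<And>v. v \<in> verts G \<Longrightarrow> l v = l' v"
  shows "cw_labelled k G l'"
proof -
  obtain m where m: "cw_constructible k G m" "\<forall>v\<in>verts G. m v = l v"
    using assms(1) unfolding cw_labelled_def by blast
  have "\<forall>v\<in>verts G. m v = l' v"
    using m(2) assms(2) by metis
  with m(1) show ?thesis
    unfolding cw_labelled_def by blast
qed

lemma cw_labelled_vertex: "l v < k \<Longrightarrow> cw_labelled k \<lparr>verts = {v}, edges = {}\<rparr> l"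
  unfolding cw_labelled_def by (blast intro: cw_constructible.vertex)

lemma cw_labelled_union:
  assumes "cw_labelled k G l" "cw_labelled k H l" "verts G \<inter> verts H = {}"
  shows "cw_labelled k \<lparr>verts = verts G \<union> verts H, edges = edges G \<union> edges H\<rparr> l"
proof -
  obtain m m' where m: "cw_constructible k G m" "\<forall>v\<in>verts G. m v = l v"
    "cw_constructible k H m'" "\<forall>v\<in>verts H. m' v = l v"
    using assms(1,2) unfolding cw_labelled_def by blast
  show ?thesis
    unfolding cw_labelled_def
    by (rule exI, rule conjI, rule cw_constructible.disjoint_union[OF m(1) m(3) assms(3)])
      (use m in auto)
qed

lemma cw_labelled_join:
  assumes "cw_labelled k G l" "i < k" "j < k" "i \<noteq> j"
  shows "cw_labelled k \<lparr>verts = verts G,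
    edges = edges G \<union> {{x, y} |x y. x \<in> verts G \<and> y \<in> verts G \<and> l x = i \<and> l y = j}\<rparr> l"
proof -
  obtain m where m: "cw_constructible k G m" "\<forall>v\<in>verts G. m v = l v"
    using assms(1) unfolding cw_labelled_def by blast
  have "{{x, y} |x y. x \<in> verts G \<and> y \<in> verts G \<and> l x = i \<and> l y = j} =
      {{x, y} |x y. x \<in> verts G \<and> y \<in> verts G \<and> m x = i \<and> m y = j}"
    using m(2) by (metis (no_types, lifting))
  then show ?thesis
    using cw_constructible.join[OF m(1) assms(2-4)] m(2) unfolding cw_labelled_def
    by (intro exI[of _ m]) simp
qed

lemma cw_labelled_relabel_one:
  assumes "cw_labelled k G l" "i < k" "j < k"
  shows "cw_labelled k G (\<lambda>v. if l v = i then j else l v)"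
proof -
  obtain m where m: "cw_constructible k G m" "\<forall>v\<in>verts G. m v = l v"
    using assms(1) unfolding cw_labelled_def by blast
  show ?thesis
    using cw_constructible.relabel[OF m(1) assms(2,3)] m(2) unfolding cw_labelled_def
    by (intro exI[of _ "\<lambda>v. if m v = i then j else m v"]) simp
qed

lemma cw_labelled_joins:
  assumes "finite J" "J \<subseteq> {(i, j). i < k \<and> j < k \<and> i \<noteq> j}" "cw_labelled k G l"
  shows "cw_labelled k \<lparr>verts = verts G,
    edges = edges G \<union> {{x, y} |x y. x \<in> verts G \<and> y \<in> verts G \<and> (l x, l y) \<in> J}\<rparr> l"
  using assms(1,2)
proof (induction J rule: finite_induct)
  case empty
  show ?case
    using assms(3) by (cases G) simp
next
  case (insert p J)
  obtain i j where p: "p = (i, j)"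
    by force
  then have ij: "i < k" "j < k" "i \<noteq> j"
    using insert.prems by auto
  let ?E = "\<lambda>J. {{x, y} |x y. x \<in> verts G \<and> y \<in> verts G \<and> (l x, l y) \<in> J}"
  have "cw_labelled k \<lparr>verts = verts G, edges = edges G \<union> ?E J\<rparr> l"
    using insert by auto
  from cw_labelled_join[OF this ij]
  have "cw_labelled k \<lparr>verts = verts G, edges = (edges G \<union> ?E J) \<union> ?E {p}\<rparr> l"
    by (simp add: p)
  moreover have "(edges G \<union> ?E J) \<union> ?E {p} = edges G \<union> ?E (insert p J)"
    by blast
  ultimately show ?case
    by simp
qed

text \<open>Labels are changed one at a time. Because \<open>g\<close> leaves \<open>B\<close>, a
  vertex already relabelled never carries a label still waiting its turn, so the result equals the
  simultaneous relabelling.\<close>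

lemma cw_labelled_relabel_away:
  assumes "finite A" "A \<subseteq> B" "\<And>i. i \<in> B \<Longrightarrow> i < k \<and> g i < k \<and> g i \<notin> B" "cw_labelled k G l"
  shows "cw_labelled k G (\<lambda>v. if l v \<in> A then g (l v) else l v)"
  using assms(1,2)
proof (induction A rule: finite_induct)
  case empty
  show ?case
    using assms(4) by simp
next
  case (insert i A)
  have i: "i < k" "g i < k"
    using insert.prems assms(3) by auto
  have "cw_labelled k G (\<lambda>v. if l v \<in> A then g (l v) else l v)"
    using insert by auto
  from cw_labelled_relabel_one[OF this i] show ?case
  proof (rule cw_labelled_cong)
    fix v
    have "g (l v) \<noteq> i" if "l v \<in> A"
      using that insert.prems assms(3) by blast
    then show "(if (if l v \<in> A then g (l v) else l v) = i then g i
        else if l v \<in> A then g (l v) else l v) =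
      (if l v \<in> insert i A then g (l v) else l v)"
      using insert.hyps by auto
  qed
qed

text \<open>An arbitrary \<open>f\<close> may permute labels, which successive relabellings would
  confuse. Hence the labels first move to \<open>k + f i\<close> in the spare half
  \<open>{k..<2*k}\<close> and then back down.\<close>

lemma cw_labelled_relabel:
  assumes "cw_labelled (2 * k) G l" "\<And>v. v \<in> verts G \<Longrightarrow> l v < k \<and> f (l v) < k"
  shows "cw_labelled (2 * k) G (\<lambda>v. f (l v))"
proof -
  \<comment> \<open>\<open>f\<close> is controlled only on labels that occur; the default
    \<open>0\<close> keeps the targets of the remaining ones below \<open>2 * k\<close>.\<close>
  let ?f = "\<lambda>i. if f i < k then f i else 0"
  have "cw_labelled (2 * k) G (\<lambda>v. if l v \<in> {..<k} then k + ?f (l v) else l v)"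
    by (rule cw_labelled_relabel_away[OF _ order_refl _ assms(1)]) auto
  then have "cw_labelled (2 * k) G (\<lambda>v. k + f (l v))"
    by (rule cw_labelled_cong) (use assms(2) in auto)
  then have "cw_labelled (2 * k) G
      (\<lambda>v. if k + f (l v) \<in> {k..<2*k} then k + f (l v) - k else k + f (l v))"
    by (rule cw_labelled_relabel_away[OF _ order_refl, where g = "\<lambda>i. i - k", rotated 2]) auto
  then show ?thesis
    by (rule cw_labelled_cong) (use assms(2) in auto)
qed

text \<open>The labels of \<open>H\<close> are shifted into the spare half, so a join of
  \<open>i\<close> with \<open>k + j\<close> adds edges only across the two sides and is legal even
  for \<open>i = j\<close>. Afterwards the spare half is shifted back.\<close>

lemma cw_labelled_homogeneous_union:
  assumes "cw_labelled (2 * k) G l" "cw_labelled (2 * k) H l" "verts G \<inter> verts H = {}"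
    and lt: "\<And>v. v \<in> verts G \<union> verts H \<Longrightarrow> l v < k"
  shows "cw_labelled (2 * k) \<lparr>verts = verts G \<union> verts H, edges = edges G \<union> edges H \<union>
    {{x, y} |x y. x \<in> verts G \<and> y \<in> verts H \<and> (l x, l y) \<in> J}\<rparr> l"
proof -
  define m where "m = (\<lambda>v. if v \<in> verts G then l v else k + l v)"
  define J' where "J' = {(i, k + j) |i j. i < k \<and> j < k \<and> (i, j) \<in> J}"
  have "cw_labelled (2 * k) H (\<lambda>v. if l v \<in> {..<k} then k + l v else l v)"
    by (rule cw_labelled_relabel_away[OF _ order_refl _ assms(2)]) auto
  then have "cw_labelled (2 * k) H m"
    by (rule cw_labelled_cong) (use lt assms(3) in \<open>auto simp: m_def\<close>)
  moreover have "cw_labelled (2 * k) G m"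
    by (rule cw_labelled_cong[OF assms(1)]) (auto simp: m_def)
  ultimately have u: "cw_labelled (2 * k)
      \<lparr>verts = verts G \<union> verts H, edges = edges G \<union> edges H\<rparr> m"
    using assms(3) by (intro cw_labelled_union)
  have "finite J'"
    by (rule finite_subset[of _ "{..<2*k} \<times> {..<2*k}"]) (auto simp: J'_def)
  from cw_labelled_joins[OF this _ u]
  have j: "cw_labelled (2 * k) \<lparr>verts = verts G \<union> verts H, edges = edges G \<union> edges H \<union>
    {{x, y} |x y. x \<in> verts G \<union> verts H \<and> y \<in> verts G \<union> verts H \<and> (m x, m y) \<in> J'}\<rparr> m"
    by (force simp: J'_def)
  have m_iff: "(m x, m y) \<in> J' \<longleftrightarrow> x \<in> verts G \<and> y \<in> verts H \<and> (l x, l y) \<in> J"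
    if "x \<in> verts G \<union> verts H" "y \<in> verts G \<union> verts H" for x y
    using that lt[OF that(1)] lt[OF that(2)] assms(3) unfolding m_def J'_def by auto
  have "{{x, y} |x y. x \<in> verts G \<union> verts H \<and> y \<in> verts G \<union> verts H \<and> (m x, m y) \<in> J'} =
      {{x, y} |x y. x \<in> verts G \<and> y \<in> verts H \<and> (l x, l y) \<in> J}"
    (is "?L = ?R")
  proof
    show "?L \<subseteq> ?R"
      using m_iff by blast
    show "?R \<subseteq> ?L"
    proof
      fix e assume "e \<in> ?R"
      then obtain x y where "e = {x, y}" "x \<in> verts G" "y \<in> verts H" "(l x, l y) \<in> J"
        by blast
      then show "e \<in> ?L"
        using m_iff[of x y] by blast
    qed
  qed
  with j have "cw_labelled (2 * k) \<lparr>verts = verts G \<union> verts H, edges = edges G \<union> edges H \<union>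
      {{x, y} |x y. x \<in> verts G \<and> y \<in> verts H \<and> (l x, l y) \<in> J}\<rparr> m" (is "cw_labelled _ ?U _")
    by simp
  then have "cw_labelled (2 * k) ?U
      (\<lambda>v. if m v \<in> {k..<2*k} then m v - k else m v)"
    by (rule cw_labelled_relabel_away[OF _ order_refl, where g = "\<lambda>i. i - k", rotated 2]) auto
  then show ?thesis
    by (rule cw_labelled_cong) (use lt in \<open>force simp: m_def\<close>)
qed

subsection \<open>From chains of partitions to clique-width\<close>

definition induced_subgraph :: "'a ugraph \<Rightarrow> 'a set \<Rightarrow> 'a ugraph" where
  "induced_subgraph G B = \<lparr>verts = B, edges = {e \<in> edges G. e \<subseteq> B}\<rparr>"

definition same_part :: "'a set set \<Rightarrow> 'a \<Rightarrow> 'a \<Rightarrow> bool" where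
  "same_part P x y \<longleftrightarrow> (\<exists>X\<in>P. x \<in> X \<and> y \<in> X)"

text \<open>An implication suffices: \<open>same_part\<close> is symmetric, so exchanging the two
  pairs gives an equivalence. Both pairs have their ends on the same sides, so parts may straddle
  the cut.\<close>

definition homogeneous_between :: "'a ugraph \<Rightarrow> 'a set set \<Rightarrow> 'a set \<Rightarrow> 'a set \<Rightarrow> bool" where
  "homogeneous_between G P B C \<longleftrightarrow>
     (\<forall>x\<in>B. \<forall>x'\<in>B. \<forall>y\<in>C. \<forall>y'\<in>C. same_part P x x' \<longrightarrow> same_part P y y' \<longrightarrow>
        {x, y} \<in> edges G \<longrightarrow> {x', y'} \<in> edges G)"

text \<open>Equal labels imply equal parts, so the label pairs realised by edges across the cut
  describe all edges across it.\<close>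

lemma cw_labelled_induced_union:
  assumes G: "simple_graph G" and disj: "B \<inter> C = {}"
    and B: "cw_labelled (2 * k) (induced_subgraph G B) l"
    and C: "cw_labelled (2 * k) (induced_subgraph G C) l"
    and lt: "\<And>v. v \<in> B \<union> C \<Longrightarrow> l v < k"
    and l: "\<And>x y. x \<in> B \<union> C \<Longrightarrow> y \<in> B \<union> C \<Longrightarrow> l x = l y \<Longrightarrow> same_part P x y"
    and hom: "homogeneous_between G P B C"
  shows "cw_labelled (2 * k) (induced_subgraph G (B \<union> C)) l"
proof -
  define J where "J = {(l x, l y) |x y. x \<in> B \<and> y \<in> C \<and> {x, y} \<in> edges G}"
  have J: "{x, y} \<in> edges G" if xy: "x \<in> B" "y \<in> C" "(l x, l y) \<in> J" for x y
  proof -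
    obtain x' y' where x': "l x = l x'" "l y = l y'" "x' \<in> B" "y' \<in> C" "{x', y'} \<in> edges G"
      using xy(3) unfolding J_def by auto
    have "same_part P x' x" "same_part P y' y"
      using x' xy l by auto
    then show ?thesis
      using hom x' xy unfolding homogeneous_between_def by blast
  qed
  have "cw_labelled (2 * k) \<lparr>verts = B \<union> C, edges = {e \<in> edges G. e \<subseteq> B} \<union> {e \<in> edges G. e \<subseteq> C} \<union>
      {{x, y} |x y. x \<in> B \<and> y \<in> C \<and> (l x, l y) \<in> J}\<rparr> l"
    using cw_labelled_homogeneous_union[OF B C, of J] disj lt
    unfolding induced_subgraph_def by simp
  moreover have "{e \<in> edges G. e \<subseteq> B} \<union> {e \<in> edges G. e \<subseteq> C} \<union>
      {{x, y} |x y. x \<in> B \<and> y \<in> C \<and> (l x, l y) \<in> J} = {e \<in> edges G. e \<subseteq> B \<union> C}" (is "?L = ?R")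
  proof
    show "?L \<subseteq> ?R"
      using J by blast
    show "?R \<subseteq> ?L"
    proof
      fix e assume e: "e \<in> ?R"
      then have "e \<in> [verts G]\<^bsup>2\<^esup>"
        using G unfolding simple_graph_def by auto
      then obtain x y where xy: "e = {x, y}"
        by (auto elim: nsets2_E)
      consider "x \<in> B" "y \<in> C" | "y \<in> B" "x \<in> C" | "e \<subseteq> B" | "e \<subseteq> C"
        using e xy by blast
      then show "e \<in> ?L"
      proof cases
        case 1
        then have "(l x, l y) \<in> J"
          using e xy unfolding J_def by blast
        then show ?thesis
          using 1 xy by blast
      next
        case 2
        moreover have "e = {y, x}"
          using xy by auto
        ultimately have "(l y, l x) \<in> J"
          using e unfolding J_def by blast
        then show ?thesis
          using 2 \<open>e = {y, x}\<close> by blast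
      qed (use e in auto)
    qed
  qed
  ultimately show ?thesis
    unfolding induced_subgraph_def by simp
qed

text \<open>The hypothesis \<open>split\<close> may assume that \<open>C\<close> has no expression
  for \<open>l\<close>. A caller is thus free to build \<open>C\<close> by other means, such as the
  expression for a finer partition, and to split only when that fails.\<close>

lemma cw_labelled_by_splitting:
  assumes G: "simple_graph G" and "finite B" "B \<noteq> {}"
    and lt: "\<And>v. v \<in> B \<Longrightarrow> l v < k"
    and l: "\<And>x y. x \<in> B \<Longrightarrow> y \<in> B \<Longrightarrow> l x = l y \<Longrightarrow> same_part P x y"
    and split: "\<And>C. \<lbrakk>C \<subseteq> B; C \<noteq> {}; \<not> cw_labelled (2 * k) (induced_subgraph G C) l\<rbrakk> \<Longrightarrow>
      \<exists>D E. D \<union> E = C \<and> D \<inter> E = {} \<and> D \<noteq> {} \<and> E \<noteq> {} \<and> homogeneous_between G P D E"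
  shows "cw_labelled (2 * k) (induced_subgraph G B) l"
proof -
  have "cw_labelled (2 * k) (induced_subgraph G C) l" if "C \<subseteq> B" "C \<noteq> {}" for C
    using finite_subset[OF that(1) assms(2)] that
  proof (induction C rule: finite_psubset_induct)
    case (psubset C)
    show ?case
    proof (rule ccontr)
      assume no: "\<not> ?thesis"
      from split[OF psubset.prems this] obtain D E
        where DE: "D \<union> E = C" "D \<inter> E = {}" "D \<noteq> {}" "E \<noteq> {}" "homogeneous_between G P D E"
        by blast
      have "D \<subset> C" "D \<subseteq> B" "E \<subset> C" "E \<subseteq> B"
        using DE(1-4) psubset.prems(1) by blast+
      then have "cw_labelled (2 * k) (induced_subgraph G D) l" "cw_labelled (2 * k) (induced_subgraph G E) l"
        using psubset.IH DE(3,4) by simp_all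
      moreover have "l v < k" if "v \<in> D \<union> E" for v
        using that lt[of v] DE(1) psubset.prems(1) by blast
      moreover have "same_part P x y" if "x \<in> D \<union> E" "y \<in> D \<union> E" "l x = l y" for x y
        using that l[of x y] DE(1) psubset.prems(1) by blast
      ultimately have "cw_labelled (2 * k) (induced_subgraph G (D \<union> E)) l"
        by (intro cw_labelled_induced_union[OF G DE(2) _ _ _ _ DE(5)])
      then show False
        using no DE(1) by simp
    qed
  qed
  then show ?thesis
    using assms(3) by blast
qed

lemma injective_part_labelling:
  assumes "partition_on V P" "finite V" "C \<subseteq> V" "card (parts_meeting C P) \<le> k"
  obtains l :: "'a \<Rightarrow> nat" where "\<And>x. x \<in> C \<Longrightarrow> l x < k"
    "\<And>x y. x \<in> C \<Longrightarrow> y \<in> C \<Longrightarrow> l x = l y \<longleftrightarrow> same_part P x y"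
proof -
  have "finite (parts_meeting C P)"
    using finite_elements[OF assms(2,1)] unfolding parts_meeting_def by simp
  then obtain g :: "'a set \<Rightarrow> nat" where g: "g ` parts_meeting C P \<subseteq> {..<k}" "inj_on g (parts_meeting C P)"
    using card_le_inj[of "parts_meeting C P" "{..<k}"] assms(4) by auto
  have "\<forall>x\<in>C. \<exists>X. X \<in> P \<and> x \<in> X"
    using assms(1,3) unfolding partition_on_def by blast
  from bchoice[OF this] obtain p where p: "\<And>x. x \<in> C \<Longrightarrow> p x \<in> P" "\<And>x. x \<in> C \<Longrightarrow> x \<in> p x"
    by blast
  have pm: "p x \<in> parts_meeting C P" if "x \<in> C" for x
    using p that unfolding parts_meeting_def by blast
  show ?thesis
  proof (rule that[of "\<lambda>x. g (p x)"])
    show "g (p x) < k" if "x \<in> C" for x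
      using g(1) pm[OF that] by auto
    show "g (p x) = g (p y) \<longleftrightarrow> same_part P x y" if "x \<in> C" "y \<in> C" for x y
    proof -
      have "g (p x) = g (p y) \<longleftrightarrow> p x = p y"
        using inj_on_eq_iff[OF g(2) pm[OF that(1)] pm[OF that(2)]] .
      also have "\<dots> \<longleftrightarrow> same_part P x y"
        unfolding same_part_def using p that partition_on_disjointD[OF assms(1)] by metis
      finally show ?thesis .
    qed
  qed
qed

text \<open>
  \<open>E t x y\<close> expresses that \<open>x\<close> and \<open>y\<close> cannot be separated at time \<open>t\<close>. A set that contains a
  separable pair falls apart into two smaller sets with homogeneous adjacency; a set without
  such a pair meets few parts of the previous partition and is handled at the previous time.
\<close>

lemma cw_constructible_of_chain:
  assumes G: "simple_graph G" and chain: "partition_chain (verts G) m P"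
    and ne: "verts G \<noteq> {}" and "1 \<le> k"
    and sep: "\<And>t B x y. \<lbrakk>t \<in> {1..m}; B \<subseteq> verts G; x \<in> B; y \<in> B; \<not> E t x y\<rbrakk> \<Longrightarrow>
      \<exists>C D. C \<union> D = B \<and> C \<inter> D = {} \<and> C \<noteq> {} \<and> D \<noteq> {} \<and> homogeneous_between G (P t) C D"
    and width: "\<And>t v. \<lbrakk>t \<in> {1..<m}; v \<in> verts G\<rbrakk> \<Longrightarrow>
      card (parts_meeting {u \<in> verts G. E (t + 1) v u} (P t)) \<le> k"
  shows "\<exists>l. cw_constructible (2 * k) G l"
proof -
  have fin: "finite (verts G)"
    using G unfolding simple_graph_def by simp
  have part: "partition_on (verts G) (P t)" if "t \<in> {1..m}" for t
    using chain that unfolding partition_chain_def by blast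
  have claim: "cw_labelled (2 * k) (induced_subgraph G B) l"
    if "t \<in> {1..m}" "B \<subseteq> verts G" "B \<noteq> {}" "\<And>x. x \<in> B \<Longrightarrow> l x < k"
      "\<And>x y. x \<in> B \<Longrightarrow> y \<in> B \<Longrightarrow> l x = l y \<longleftrightarrow> same_part (P t) x y" for t B l
    using that
  proof (induction t arbitrary: B l)
    case 0
    then show ?case by simp
  next
    case (Suc t)
    have finB: "finite B"
      using Suc.prems(2) fin finite_subset by blast
    show ?case
    proof (rule cw_labelled_by_splitting[OF G finB Suc.prems(3,4)])
      show "same_part (P (Suc t)) x y" if "x \<in> B" "y \<in> B" "l x = l y" for x y
        using Suc.prems(5) that by blast
    next
      fix C assume C: "C \<subseteq> B" "C \<noteq> {}" and no: "\<not> cw_labelled (2 * k) (induced_subgraph G C) l"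
      have CV: "C \<subseteq> verts G"
        using C Suc.prems(2) by blast
      obtain x where x: "x \<in> C"
        using C by blast
      have "C \<noteq> {x}"
      proof
        assume "C = {x}"
        moreover have "{e \<in> edges G. e \<subseteq> {x}} = {}"
        proof -
          have "card e = 2" if "e \<in> edges G" for e
            using that G unfolding simple_graph_def nsets_def by blast
          then have "\<not> e \<subseteq> {x}" if "e \<in> edges G" for e
            using that card_mono[of "{x}" e] by fastforce
          then show ?thesis
            by blast
        qed
        ultimately have "induced_subgraph G C = \<lparr>verts = {x}, edges = {}\<rparr>"
          unfolding induced_subgraph_def by simp
        then have "cw_labelled (2 * k) (induced_subgraph G C) l"
          using cw_labelled_vertex[of l x "2 * k"] Suc.prems(4)[of x] C(1) x by auto
        then show False
          using no by simp
      qed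
      then obtain y where y: "y \<in> C" "y \<noteq> x"
        using x by blast
      show "\<exists>D E. D \<union> E = C \<and> D \<inter> E = {} \<and> D \<noteq> {} \<and> E \<noteq> {} \<and>
          homogeneous_between G (P (Suc t)) D E"
      \<comment> \<open>The first partition consists of singletons, for which every cut is
        homogeneous, so a single vertex can be peeled off.\<close>
      proof (cases "t = 0")
        case True
        then have "P (Suc t) = (\<lambda>v. {v}) ` verts G"
          using chain unfolding partition_chain_def by simp
        then have "same_part (P (Suc t)) u v \<Longrightarrow> u = v" for u v
          unfolding same_part_def by auto
        then have "homogeneous_between G (P (Suc t)) D E" for D E
          unfolding homogeneous_between_def by metis
        then show ?thesis
          using x y by (intro exI[of _ "{x}"] exI[of _ "C - {x}"]) auto
      next
        case False
        then have t: "t \<in> {1..m}" "t \<in> {1..<m}"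
          using Suc.prems(1) by auto
        show ?thesis
        proof (cases "\<forall>u\<in>C. E (Suc t) x u")
          case True
          have "C \<subseteq> {u \<in> verts G. E (t + 1) x u}"
            using True CV by auto
          then have "card (parts_meeting C (P t)) \<le> k"
            using card_parts_meeting_mono[OF _ finite_elements[OF fin part[OF t(1)]]]
              width[OF t(2), of x] x CV by (meson order_trans subsetD)
          from injective_part_labelling[OF part[OF t(1)] fin CV this]
          obtain l' where l': "\<And>x. x \<in> C \<Longrightarrow> l' x < k"
            "\<And>x y. x \<in> C \<Longrightarrow> y \<in> C \<Longrightarrow> l' x = l' y \<longleftrightarrow> same_part (P t) x y"
            by blast
          have cw: "cw_labelled (2 * k) (induced_subgraph G C) l'"
            using Suc.IH[OF t(1) CV C(2)] l' by blast
          have ref: "refines (verts G) (P t) (P (Suc t))"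
            using chain t(2) unfolding partition_chain_def by simp
          have eq: "l u = l v" if uv: "u \<in> C" "v \<in> C" "l' u = l' v" for u v
          proof -
            have "same_part (P t) u v"
              using l'(2) uv by blast
            then have "same_part (P (Suc t)) u v"
              using ref unfolding refines_def same_part_def by blast
            then show ?thesis
              using Suc.prems(5) uv C(1) by blast
          qed
          \<comment> \<open>Labels of the earlier time refine those of the later one, so
            \<open>l\<close> factors through \<open>l'\<close>; \<open>f\<close> is this
            factor.\<close>
          define f where "f i = l (SOME u. u \<in> C \<and> l' u = i)" for i
          have f: "f (l' u) = l u" if u: "u \<in> C" for u
          proof -
            have "(SOME w. w \<in> C \<and> l' w = l' u) \<in> C \<and> l' (SOME w. w \<in> C \<and> l' w = l' u) = l' u"
              by (rule someI[of "\<lambda>w. w \<in> C \<and> l' w = l' u" u]) (use u in simp)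
            then show ?thesis
              unfolding f_def using eq u by blast
          qed
          have V: "verts (induced_subgraph G C) = C"
            unfolding induced_subgraph_def by simp
          have "cw_labelled (2 * k) (induced_subgraph G C) (\<lambda>v. f (l' v))"
            using Suc.prems(4) C(1) f l'(1) by (intro cw_labelled_relabel[OF cw]) (auto simp: V)
          then have "cw_labelled (2 * k) (induced_subgraph G C) l"
            by (rule cw_labelled_cong) (use f V in auto)
          then show ?thesis
            using no by blast
        next
          case False
          then obtain u where "u \<in> C" "\<not> E (Suc t) x u"
            by blast
          then show ?thesis
            using sep[OF Suc.prems(1) CV x] by blast
        qed
      qed
    qed
  qed
  have m: "m \<in> {1..m}" "P m = {verts G}"
    using chain ne unfolding partition_chain_def by auto
  \<comment> \<open>At the last time there is only one part, so a constant labelling meets the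
    requirements of \<open>claim\<close>.\<close>
  have "cw_labelled (2 * k) (induced_subgraph G (verts G)) (\<lambda>_. 0)"
    using ne assms(4) m by (intro claim[OF m(1)]) (auto simp: same_part_def)
  moreover have "induced_subgraph G (verts G) = G"
  proof -
    have "{e \<in> edges G. e \<subseteq> verts G} = edges G"
      using G unfolding simple_graph_def nsets_def by blast
    then show ?thesis
      unfolding induced_subgraph_def by (cases G) simp
  qed
  ultimately show ?thesis
    unfolding cw_labelled_def by auto
qed

subsection \<open>Bounding clique-width\<close>

text \<open>\<open>enat\<close> is discrete: an element below \<open>Suc k\<close> is at most
  \<open>k\<close>, so a finite bound on an infimum is met by an element.\<close>

lemma Inf_le_enatE:
  assumes "Inf A \<le> enat k"
  obtains x where "x \<in> A" "x \<le> enat k"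
proof -
  have "Inf A < enat (Suc k)"
    using assms by (meson enat_ord_simps(2) le_less_trans lessI)
  then obtain x where "x \<in> A" "x < enat (Suc k)"
    unfolding Inf_less_iff by blast
  then show ?thesis
    using that by (cases x) auto
qed

lemma clique_width_le: "cw_constructible k G l \<Longrightarrow> clique_width G \<le> enat k"
  unfolding clique_width_def by (intro Inf_lower) blast

lemma clique_width_empty: "verts G = {} \<Longrightarrow> clique_width G = 0"
  unfolding clique_width_def zero_enat_def[symmetric]
  by (metis (mono_tags, lifting) Inf_lower ile0_eq mem_Collect_eq zero_enat_def)

text \<open>The cut is the part of \<open>B\<close> reachable from \<open>x\<close> against the
  rest. Paths may leave \<open>B\<close>; still no pair of \<open>r\<close> leads across, since its
  end would be reachable too.\<close>

lemma separate_reachable: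
  assumes "(x, y) \<notin> r\<^sup>*" "x \<in> B" "y \<in> B"
    and "\<And>C D. \<lbrakk>\<And>c d. c \<in> C \<Longrightarrow> d \<in> D \<Longrightarrow> (c, d) \<notin> r; C \<inter> D = {}\<rbrakk> \<Longrightarrow> homogeneous_between G P C D"
  shows "\<exists>C D. C \<union> D = B \<and> C \<inter> D = {} \<and> C \<noteq> {} \<and> D \<noteq> {} \<and> homogeneous_between G P C D"
proof -
  let ?C = "{z \<in> B. (x, z) \<in> r\<^sup>*}" and ?D = "{z \<in> B. (x, z) \<notin> r\<^sup>*}"
  have "homogeneous_between G P ?C ?D"
    by (rule assms(4)) (auto intro: rtrancl_into_rtrancl)
  moreover have "?C \<noteq> {}" "?D \<noteq> {}" "?C \<union> ?D = B" "?C \<inter> ?D = {}"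
    using assms(1-3) by auto
  ultimately show ?thesis
    by blast
qed

lemma clique_width_le_mw:
  assumes G: "simple_graph G" and "mw \<infinity> G \<le> enat k"
  shows "clique_width G \<le> enat (2 * Suc k)"
proof (cases "verts G = {}")
  case False
  obtain m P R where ms: "merge_sequence G m P R" and w: "merge_sequence_width \<infinity> G m P R \<le> enat k"
    using assms(2) unfolding mw_def by (elim Inf_le_enatE) blast
  let ?H = "\<lambda>t. \<lparr>verts = verts G, edges = R t\<rparr>"
  \<comment> \<open>\<open>Suc k\<close> and not \<open>k\<close>: for a one-vertex graph the chain
    can have length \<open>1\<close>, the width is then an empty supremum, and still one label is
    needed.\<close>
  have "\<exists>l. cw_constructible (2 * Suc k) G l"
  proof (rule cw_constructible_of_chain[OF G _ False, where E = "\<lambda>t x y. (x, y) \<in> (adj_rel (?H t))\<^sup>*"])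
    show "partition_chain (verts G) m P"
      using ms unfolding merge_sequence_def by blast
    fix t B x y
    assume t: "t \<in> {1..m}" and xy: "x \<in> B" "y \<in> B" "(x, y) \<notin> (adj_rel (?H t))\<^sup>*"
    show "\<exists>C D. C \<union> D = B \<and> C \<inter> D = {} \<and> C \<noteq> {} \<and> D \<noteq> {} \<and> homogeneous_between G (P t) C D"
    proof (rule separate_reachable[OF xy(3,1,2)])
      fix C D
      assume CD: "\<And>c d. c \<in> C \<Longrightarrow> d \<in> D \<Longrightarrow> (c, d) \<notin> adj_rel (?H t)" "C \<inter> D = {}"
      show "homogeneous_between G (P t) C D"
        unfolding homogeneous_between_def
      proof (intro ballI impI)
        fix x x' y y'
        assume a: "x \<in> C" "x' \<in> C" "y \<in> D" "y' \<in> D" "same_part (P t) x x'" "same_part (P t) y y'"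
          "{x, y} \<in> edges G"
        have ne: "x \<noteq> y" "x' \<noteq> y'" "{x, y} \<notin> R t" "{x', y'} \<notin> R t"
          using CD(1)[of x y] CD(1)[of x' y'] CD(2) a by auto
        obtain X Y where XY: "X \<in> P t" "x \<in> X" "x' \<in> X" "Y \<in> P t" "y \<in> Y" "y' \<in> Y"
          using a(5,6) unfolding same_part_def by blast
        have "homogeneous_mod G (P t) (R t)"
          using ms t unfolding merge_sequence_def by blast
        from this[unfolded homogeneous_mod_def, rule_format, OF XY(1) XY(4)]
        show "{x', y'} \<in> edges G"
          using XY ne a(7) by blast
      qed
    qed
  next
    fix t v assume t: "t \<in> {1..<m}" and v: "v \<in> verts G"
    have "enat (card (parts_meeting (graph_ball (?H (t + 1)) \<infinity> v) (P t))) \<le> enat k"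
      using w t v unfolding merge_sequence_width_def SUP_le_iff by blast
    then show "card (parts_meeting {u \<in> verts G. (v, u) \<in> (adj_rel (?H (t + 1)))\<^sup>*} (P t)) \<le> Suc k"
      by (simp add: graph_ball_infinity)
  qed simp
  then show ?thesis
    using clique_width_le by blast
qed (simp add: clique_width_empty)

section \<open>Separation by flips\<close>

lemma flip_by_edge_iff:
  "{x, y} \<in> edges (flip_by G F) \<longleftrightarrow>
     ({x, y} \<in> edges G) \<noteq> (x \<noteq> y \<and> (\<exists>(X, Y)\<in>F. x \<in> X \<and> y \<in> Y \<or> y \<in> X \<and> x \<in> Y))"
proof -
  have "{x, y} \<in> {{x, y} |x y. x \<noteq> y \<and> (\<exists>(X, Y)\<in>F. x \<in> X \<and> y \<in> Y)} \<longleftrightarrow>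
      x \<noteq> y \<and> (\<exists>(X, Y)\<in>F. x \<in> X \<and> y \<in> Y \<or> y \<in> X \<and> x \<in> Y)"
    by (auto simp: doubleton_eq_iff)
  then show ?thesis
    unfolding flip_by_def by auto
qed

lemma clique_width_le_pmw:
  assumes G: "simple_graph G" and "pmw \<infinity> G \<le> enat k"
  shows "clique_width G \<le> enat (2 * Suc k)"
proof (cases "verts G = {}")
  case False
  obtain m P where chain: "partition_chain (verts G) m P"
    and w: "(SUP i\<in>{1..<m}. SUP v\<in>verts G.
      enat (card (parts_meeting (flip_ball G (P (i + 1)) \<infinity> v) (P i)))) \<le> enat k"
    using assms(2) unfolding pmw_def by (elim Inf_le_enatE) blast
  have part: "partition_on (verts G) (P t)" if "t \<in> {1..m}" for t
    using chain that unfolding partition_chain_def by blast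
  have fin: "finite (P t)" if "t \<in> {1..m}" for t
    using finite_elements[OF _ part[OF that]] G unfolding simple_graph_def by blast
  have "\<exists>l. cw_constructible (2 * Suc k) G l"
  proof (rule cw_constructible_of_chain[OF G chain False,
        where E = "\<lambda>t x y. \<forall>H\<in>flips G (P t). (x, y) \<in> (adj_rel H)\<^sup>*"])
    fix t B x y
    assume t: "t \<in> {1..m}" and xy: "x \<in> B" "y \<in> B"
      "\<not> (\<forall>H\<in>flips G (P t). (x, y) \<in> (adj_rel H)\<^sup>*)"
    then obtain F where F: "F \<subseteq> P t \<times> P t" "(x, y) \<notin> (adj_rel (flip_by G F))\<^sup>*"
      unfolding flips_def by blast
    show "\<exists>C D. C \<union> D = B \<and> C \<inter> D = {} \<and> C \<noteq> {} \<and> D \<noteq> {} \<and> homogeneous_between G (P t) C D"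
    proof (rule separate_reachable[OF F(2) xy(1,2)])
      fix C D
      assume CD: "\<And>c d. c \<in> C \<Longrightarrow> d \<in> D \<Longrightarrow> (c, d) \<notin> adj_rel (flip_by G F)" "C \<inter> D = {}"
      show "homogeneous_between G (P t) C D"
        unfolding homogeneous_between_def
      proof (intro ballI impI)
        fix x x' y y'
        assume a: "x \<in> C" "x' \<in> C" "y \<in> D" "y' \<in> D" "same_part (P t) x x'" "same_part (P t) y y'"
          "{x, y} \<in> edges G"
        let ?flipped = "\<lambda>x y. x \<noteq> y \<and> (\<exists>(X, Y)\<in>F. x \<in> X \<and> y \<in> Y \<or> y \<in> X \<and> x \<in> Y)"
        \<comment> \<open>A pair across the cut is no edge of the flip, so it is an edge of
          \<open>G\<close> exactly when it was complemented, and that depends only on the parts of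
          its ends.\<close>
        have iff: "{x, y} \<in> edges G \<longleftrightarrow> ?flipped x y" "{x', y'} \<in> edges G \<longleftrightarrow> ?flipped x' y'"
          using CD(1)[of x y] CD(1)[of x' y'] a(1-4) unfolding mem_Collect_eq split_conv flip_by_edge_iff
          by blast+
        have "x' \<in> Z" if "Z \<in> P t" "x \<in> Z" for Z
          using a(5) that partition_on_disjointD[OF part[OF t]] unfolding same_part_def by blast
        moreover have "y' \<in> Z" if "Z \<in> P t" "y \<in> Z" for Z
          using a(6) that partition_on_disjointD[OF part[OF t]] unfolding same_part_def by blast
        moreover obtain X Y where "(X, Y) \<in> F" "x \<in> X \<and> y \<in> Y \<or> y \<in> X \<and> x \<in> Y"
          using iff(1) a(7) by blast
        ultimately have "(X, Y) \<in> F" "x' \<in> X \<and> y' \<in> Y \<or> y' \<in> X \<and> x' \<in> Y"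
          using F(1) by blast+
        moreover have "x' \<noteq> y'"
          using CD(2) a by blast
        ultimately show "{x', y'} \<in> edges G"
          using iff(2) by blast
      qed
    qed
  next
    fix t v assume t: "t \<in> {1..<m}" and v: "v \<in> verts G"
    then have t1: "t + 1 \<in> {1..m}"
      by auto
    have "enat (card (parts_meeting (flip_ball G (P (t + 1)) \<infinity> v) (P t))) \<le> enat k"
      using w t v unfolding SUP_le_iff by blast
    then show "card (parts_meeting {u \<in> verts G. \<forall>H\<in>flips G (P (t + 1)). (v, u) \<in> (adj_rel H)\<^sup>*} (P t)) \<le> Suc k"
      unfolding flip_ball_infinity[OF fin[OF t1]] by simp
  qed simp
  then show ?thesis
    using clique_width_le by blast
qed (simp add: clique_width_empty)

text \<open>Distance with respect to a partition is a maximum over flips, so its ball lies in the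
  ball of the single flip that the sequence provides.\<close>

lemma pmw_le_tmw:
  assumes "finite (verts G)" "tmw \<infinity> G \<le> enat k"
  shows "pmw \<infinity> G \<le> enat k"
proof -
  obtain j m P H where j: "j \<le> k" and chain: "partition_chain (verts G) m P"
    and H: "\<And>i. i \<in> {1..m} \<Longrightarrow> H i \<in> flips G (P i)"
    and w: "\<And>i v. i \<in> {1..<m} \<Longrightarrow> v \<in> verts G \<Longrightarrow>
      card (parts_meeting (graph_ball (H (i + 1)) \<infinity> v) (P i)) \<le> j"
  proof -
    obtain x where "x \<le> enat k" "x \<in> {enat j |j. \<exists>m P H. partition_chain (verts G) m P \<and>
       (\<forall>i\<in>{1..m}. H i \<in> flips G (P i)) \<and>
       (\<forall>i\<in>{1..<m}. \<forall>v\<in>verts G. card (parts_meeting (graph_ball (H (i + 1)) \<infinity> v) (P i)) \<le> j)}"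
      using assms(2) unfolding tmw_def by (elim Inf_le_enatE) blast
    moreover from this obtain j where "x = enat j"
      by blast
    ultimately show ?thesis
      using that[of j] by force
  qed
  have fin: "finite (P t)" if "t \<in> {1..m}" for t
    using finite_elements[OF assms(1), of "P t"] chain that unfolding partition_chain_def by blast
  have le: "card (parts_meeting (flip_ball G (P (i + 1)) \<infinity> v) (P i)) \<le> k"
    if i: "i \<in> {1..<m}" and v: "v \<in> verts G" for i v
  proof -
    have i': "i \<in> {1..m}" "i + 1 \<in> {1..m}"
      using i by auto
    have "card (parts_meeting (flip_ball G (P (i + 1)) \<infinity> v) (P i)) \<le>
        card (parts_meeting (graph_ball (H (i + 1)) \<infinity> v) (P i))"
      by (intro card_parts_meeting_mono flip_ball_subset_graph_ball H fin i')
    then show ?thesis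
      using w[OF i v] j by linarith
  qed
  show ?thesis
    unfolding pmw_def
  proof (rule Inf_lower2)
    show "(SUP i\<in>{1..<m}. SUP v\<in>verts G.
        enat (card (parts_meeting (flip_ball G (P (i + 1)) \<infinity> v) (P i)))) \<le> enat k"
      using le by (intro SUP_least) simp
  qed (use chain in blast)
qed

subsection \<open>Atomic types\<close>

definition atomic_type :: "'a ugraph \<Rightarrow> 'a set \<Rightarrow> 'a \<Rightarrow> 'a + 'a set" where
  "atomic_type G S v = (if v \<in> S then Inl v else Inr (nbhd G v \<inter> S))"

lemma atomic_type_eq_iff:
  "atomic_type G S u = atomic_type G S v \<longleftrightarrow>
     u = v \<or> u \<notin> S \<and> v \<notin> S \<and> nbhd G u \<inter> S = nbhd G v \<inter> S"
  by (auto simp: atomic_type_def)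

lemma atomic_type_partition_eq_fibres:
  assumes "S \<subseteq> verts G"
  shows "atomic_type_partition G S = fibres (verts G) (atomic_type G S)"
proof -
  let ?V = "verts G" and ?h = "atomic_type G S"
  let ?r = "{(u, v). u \<in> ?V - S \<and> v \<in> ?V - S \<and> nbhd G u \<inter> S = nbhd G v \<inter> S}"
  have "{y \<in> ?V. ?h y = ?h x} = {x}" if "x \<in> S" for x
    using that assms by (auto simp: atomic_type_eq_iff)
  moreover have "{y \<in> ?V. ?h y = ?h x} = ?r `` {x}" if "x \<in> ?V - S" for x
    using that by (auto simp: atomic_type_eq_iff)
  ultimately have "(\<lambda>x. {y \<in> ?V. ?h y = ?h x}) ` S = (\<lambda>x. {x}) ` S"
    "(\<lambda>x. {y \<in> ?V. ?h y = ?h x}) ` (?V - S) = (?V - S) // ?r"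
    unfolding quotient_def by auto
  moreover have "?V = S \<union> (?V - S)"
    using assms by blast
  ultimately show ?thesis
    unfolding atomic_type_partition_def fibres_def by (metis (no_types, lifting) image_Un)
qed

text \<open>The new type is determined by the old one and two bits: whether the vertex is
  \<open>w\<close>, and whether it is adjacent to \<open>w\<close>.\<close>

lemma card_atomic_types_insert:
  assumes "finite X"
  shows "card (atomic_type G (insert w S) ` X) \<le> 4 * card (atomic_type G S ` X)"
proof -
  let ?g = "\<lambda>v. (atomic_type G S v, v = w, w \<in> nbhd G v)"
  have eq: "atomic_type G (insert w S) u = atomic_type G (insert w S) v" if "?g u = ?g v" for u v
    using that by (auto simp: atomic_type_eq_iff)
  have "card (atomic_type G (insert w S) ` X) \<le> card (?g ` X)"
    by (rule card_image_le_factor[OF assms eq])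
  also have "\<dots> \<le> card (atomic_type G S ` X \<times> (UNIV :: bool set) \<times> (UNIV :: bool set))"
    using assms by (intro card_mono) auto
  also have "\<dots> = 4 * card (atomic_type G S ` X)"
    by (simp add: card_cartesian_product card_UNIV_bool flip: UNIV_Times_UNIV)
  finally show ?thesis .
qed

text \<open>\<open>dmw\<close> counts the ball of a partition in its own parts, \<open>pmw\<close>
  in those of the preceding partition. The preceding one has a single further vertex in its prefix,
  which costs the factor \<open>4\<close>.\<close>

lemma pmw_le_dmw:
  assumes G: "simple_graph G" and ne: "verts G \<noteq> {}" and "dmw \<infinity> G \<le> enat k"
  shows "pmw \<infinity> G \<le> enat (4 * k)"
proof -
  let ?V = "verts G"
  define P where "P vs i = atomic_type_partition G (set (take (length vs - i) vs))" for vs i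
  obtain vs where vs: "distinct vs" "set vs = ?V"
    and w0: "(SUP i\<in>{1..length vs}. SUP v\<in>?V.
      enat (card (parts_meeting (flip_ball G (P vs i) \<infinity> v) (P vs i)))) \<le> enat k"
    using assms(3) unfolding dmw_def Let_def P_def by (elim Inf_le_enatE) blast
  have w: "card (parts_meeting (flip_ball G (P vs i) \<infinity> v) (P vs i)) \<le> k"
    if "i \<in> {1..length vs}" "v \<in> ?V" for i v
  proof -
    have "enat (card (parts_meeting (flip_ball G (P vs i) \<infinity> v) (P vs i))) \<le> enat k"
      using w0 that unfolding SUP_le_iff by blast
    then show ?thesis
      by simp
  qed
  define S where "S i = set (take (length vs - i) vs)" for i
  have fin: "finite ?V"
    using G unfolding simple_graph_def by simp
  have S: "S i \<subseteq> ?V" for i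
    using vs(2) set_take_subset unfolding S_def by fast
  have P: "P vs i = fibres ?V (atomic_type G (S i))" for i
    unfolding P_def S_def[symmetric] by (rule atomic_type_partition_eq_fibres[OF S])
  have len: "1 \<le> length vs"
    using ne vs(2) by (cases vs) auto
  have Suc_S: "S i = insert (vs ! (length vs - Suc i)) (S (Suc i))" if "i < length vs" for i
  proof -
    have "length vs - i = Suc (length vs - Suc i)"
      using that by simp
    then show ?thesis
      unfolding S_def by (simp add: take_Suc_conv_app_nth that)
  qed
  have chain: "partition_chain ?V (length vs) (P vs)"
    unfolding partition_chain_def
  proof (intro conjI ballI)
    show "1 \<le> length vs"
      by (rule len)
    show "partition_on ?V (P vs t)" for t
      unfolding P by (rule partition_on_fibres)
    show "refines ?V (P vs t) (P vs (t + 1))" if "t \<in> {1..<length vs}" for t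
      unfolding P
    proof (rule refines_fibres)
      have "S (t + 1) \<subseteq> S t"
        using Suc_S[of t] that by auto
      then show "atomic_type G (S (t + 1)) x = atomic_type G (S (t + 1)) y"
        if "atomic_type G (S t) x = atomic_type G (S t) y" for x y
        using that unfolding atomic_type_eq_iff by blast
    qed
    show "P vs 1 = (\<lambda>v. {v}) ` ?V"
      unfolding P
    proof (rule fibres_inj_on, rule inj_onI)
      fix x y assume xy: "x \<in> ?V" "y \<in> ?V" "atomic_type G (S 1) x = atomic_type G (S 1) y"
      \<comment> \<open>All vertices but the last lie in \<open>S 1\<close>, so the first partition
        has only singletons.\<close>
      have "vs = take (length vs - 1) vs @ [last vs]"
        using len by (metis append_butlast_last_id butlast_conv_take list.size(3) not_one_le_zero)
      then have "?V \<subseteq> insert (last vs) (S 1)"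
        using vs(2) unfolding S_def by (metis Un_insert_right boolean_algebra.disj_zero_right empty_set list.simps(15) order_refl set_append)
      then show "x = y"
        using xy unfolding atomic_type_eq_iff by blast
    qed
    show "P vs (length vs) = {?V} - {{}}"
      unfolding P by (rule fibres_const) (simp add: S_def atomic_type_eq_iff)
  qed
  have le: "card (parts_meeting (flip_ball G (P vs (i + 1)) \<infinity> v) (P vs i)) \<le> 4 * k"
    if i: "i \<in> {1..<length vs}" and v: "v \<in> ?V" for i v
  proof -
    let ?B = "flip_ball G (P vs (i + 1)) \<infinity> v"
    have B: "?B \<subseteq> ?V"
      unfolding flip_ball_def ball_of_infinity by blast
    have "card (parts_meeting ?B (P vs i)) \<le> 4 * card (parts_meeting ?B (P vs (i + 1)))"
      using card_atomic_types_insert[OF finite_subset[OF B fin]] Suc_S[of i] i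
      unfolding P card_parts_meeting_fibres[OF B[unfolded P] fin] by simp
    also have "\<dots> \<le> 4 * k"
      using w[of "i + 1" v] i v by simp
    finally show ?thesis .
  qed
  show ?thesis
    unfolding pmw_def
  proof (rule Inf_lower2)
    show "(SUP i\<in>{1..<length vs}. SUP v\<in>?V.
        enat (card (parts_meeting (flip_ball G (P vs (i + 1)) \<infinity> v) (P vs i)))) \<le> enat (4 * k)"
      using le by (intro SUP_least) simp
  qed (use chain in blast)
qed

subsection \<open>Laminar decompositions into sets with few external neighbourhoods\<close>

text \<open>These correspond to the distinct rows of the adjacency matrix between \<open>X\<close>
  and its complement, whose number is what module-width bounds.\<close>

definition out_nbhds :: "'a ugraph \<Rightarrow> 'a set \<Rightarrow> 'a set set" where
  "out_nbhds G X = (\<lambda>x. nbhd G x - X) ` X"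

text \<open>The sets of leaves below the nodes of a rooted binary tree with leaf set
  \<open>V\<close>.\<close>

definition binary_laminar :: "'a set \<Rightarrow> 'a set set \<Rightarrow> bool" where
  "binary_laminar V F \<longleftrightarrow>
     V \<in> F \<and> (\<forall>X\<in>F. X \<subseteq> V \<and> X \<noteq> {}) \<and> (\<forall>v\<in>V. {v} \<in> F) \<and>
     (\<forall>X\<in>F. (\<exists>v. X = {v}) \<or> (\<exists>Y\<in>F. \<exists>Z\<in>F. Y \<union> Z = X \<and> Y \<inter> Z = {})) \<and>
     (\<forall>X\<in>F. \<forall>Y\<in>F. X \<subseteq> Y \<or> Y \<subseteq> X \<or> X \<inter> Y = {})"

lemma binary_laminarD:
  assumes "binary_laminar V F"
  shows "V \<in> F" "\<forall>X\<in>F. X \<subseteq> V \<and> X \<noteq> {}" "\<forall>v\<in>V. {v} \<in> F"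
    "\<forall>X\<in>F. (\<exists>v. X = {v}) \<or> (\<exists>Y\<in>F. \<exists>Z\<in>F. Y \<union> Z = X \<and> Y \<inter> Z = {})"
    "\<forall>X\<in>F. \<forall>Y\<in>F. X \<subseteq> Y \<or> Y \<subseteq> X \<or> X \<inter> Y = {}"
  using assms unfolding binary_laminar_def by - (elim conjE, assumption)+

lemma binary_laminar_singleton: "binary_laminar {v} {{v}}"
  unfolding binary_laminar_def by simp

lemma binary_laminar_union:
  assumes "binary_laminar V F" "binary_laminar W E" "V \<inter> W = {}"
  shows "binary_laminar (V \<union> W) (insert (V \<union> W) (F \<union> E))"
proof -
  note F = binary_laminarD[OF assms(1)] and E = binary_laminarD[OF assms(2)]
  let ?U = "insert (V \<union> W) (F \<union> E)"
  have sub: "X \<subseteq> V \<union> W" if "X \<in> ?U" for X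
    using that F(2) E(2) by auto
  have disj: "X \<inter> Y = {}" if "X \<in> F" "Y \<in> E" for X Y
    using F(2)[THEN bspec, OF that(1)] E(2)[THEN bspec, OF that(2)] assms(3) by blast
  show ?thesis
    unfolding binary_laminar_def
  proof (intro conjI ballI)
    show "X \<noteq> {}" if "X \<in> ?U" for X
      using that F(2) E(2) bspec[OF F(2) F(1)] by auto
    show "{v} \<in> ?U" if "v \<in> V \<union> W" for v
      using that F(3) E(3) by auto
    show "(\<exists>v. X = {v}) \<or> (\<exists>Y\<in>?U. \<exists>Z\<in>?U. Y \<union> Z = X \<and> Y \<inter> Z = {})" if X: "X \<in> ?U" for X
    proof -
      consider "X = V \<union> W" | "X \<in> F" | "X \<in> E"
        using X by blast
      then show ?thesis
      proof cases
        case 1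
        then show ?thesis
          using F(1) E(1) assms(3) by blast
      next
        case 2
        from F(4)[THEN bspec, OF this] show ?thesis
          by blast
      next
        case 3
        from E(4)[THEN bspec, OF this] show ?thesis
          by blast
      qed
    qed
    show "X \<subseteq> Y \<or> Y \<subseteq> X \<or> X \<inter> Y = {}" if XY: "X \<in> ?U" "Y \<in> ?U" for X Y
    proof -
      consider "X = V \<union> W" | "Y = V \<union> W" | "X \<in> F" "Y \<in> F" | "X \<in> E" "Y \<in> E"
        | "X \<in> F" "Y \<in> E" | "Y \<in> F" "X \<in> E"
        using XY by blast
      then show ?thesis
        by cases (use sub[OF XY(1)] sub[OF XY(2)] F(5) E(5) disj[of X Y] disj[of Y X] in auto)
    qed
  qed (use sub in blast)+
qed

text \<open>
  The labelling \<open>l\<close> of the current graph must be constant on the fibres of \<open>lab\<close>, since it governs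
  all edges that are still to be added.
\<close>

definition cut_labelled :: "nat \<Rightarrow> 'a ugraph \<Rightarrow> ('a \<Rightarrow> nat) \<Rightarrow> 'a set \<Rightarrow> bool" where
  "cut_labelled k G l X \<longleftrightarrow> (\<exists>lab :: 'a \<Rightarrow> nat. (\<forall>x\<in>X. lab x < k) \<and>
     (\<forall>x\<in>X. \<forall>y\<in>X. lab x = lab y \<longrightarrow>
        l x = l y \<and> (\<forall>z. z \<notin> X \<longrightarrow> {x, z} \<in> edges G \<longleftrightarrow> {y, z} \<in> edges G)))"

text \<open>Suited to joins: vertices of \<open>X\<close> with equal label receive the same new
  neighbours outside \<open>X\<close>, so a labelling \<open>lab\<close> fixed when \<open>X\<close>
  was formed stays valid.\<close>

lemma cut_labelled_cong:
  assumes "cut_labelled k G l X" "\<And>x y. \<lbrakk>x \<in> X; y \<in> X; l x = l y\<rbrakk> \<Longrightarrow> l' x = l' y"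
    and "\<And>x y z. \<lbrakk>x \<in> X; y \<in> X; l x = l y; z \<notin> X; {x, z} \<in> edges G \<longleftrightarrow> {y, z} \<in> edges G\<rbrakk> \<Longrightarrow>
      {x, z} \<in> edges H \<longleftrightarrow> {y, z} \<in> edges H"
  shows "cut_labelled k H l' X"
proof -
  obtain lab :: "'a \<Rightarrow> nat" where lab: "\<forall>x\<in>X. lab x < k"
    "\<forall>x\<in>X. \<forall>y\<in>X. lab x = lab y \<longrightarrow>
        l x = l y \<and> (\<forall>z. z \<notin> X \<longrightarrow> {x, z} \<in> edges G \<longleftrightarrow> {y, z} \<in> edges G)"
    using assms(1) unfolding cut_labelled_def by (elim exE conjE)
  have "\<forall>x\<in>X. \<forall>y\<in>X. lab x = lab y \<longrightarrow>
      l' x = l' y \<and> (\<forall>z. z \<notin> X \<longrightarrow> {x, z} \<in> edges H \<longleftrightarrow> {y, z} \<in> edges H)"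
  proof (intro ballI impI)
    fix x y assume xy: "x \<in> X" "y \<in> X" "lab x = lab y"
    have l: "l x = l y" and e: "z \<notin> X \<Longrightarrow> {x, z} \<in> edges G \<longleftrightarrow> {y, z} \<in> edges G" for z
      using lab(2)[THEN bspec, OF xy(1), THEN bspec, OF xy(2), THEN mp, OF xy(3)] by blast+
    show "l' x = l' y \<and> (\<forall>z. z \<notin> X \<longrightarrow> {x, z} \<in> edges H \<longleftrightarrow> {y, z} \<in> edges H)"
      using assms(2)[OF xy(1,2) l] assms(3)[OF xy(1,2) l _ e] by blast
  qed
  with lab(1) show ?thesis
    unfolding cut_labelled_def by (intro exI[of _ lab] conjI)
qed

lemma cut_labelled_whole:
  assumes "\<And>v. v \<in> X \<Longrightarrow> l v < k" "\<And>e. e \<in> edges G \<Longrightarrow> e \<subseteq> X"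
  shows "cut_labelled k G l X"
proof -
  have "{x, z} \<notin> edges G" if "z \<notin> X" for x z
    using that assms(2)[of "{x, z}"] by blast
  then show ?thesis
    using assms(1) unfolding cut_labelled_def by (intro exI[of _ l]) simp
qed

text \<open>A disjoint union contributes its vertex set to the family; at that moment its current
  labels serve as \<open>lab\<close>. Later joins and relabellings treat equal labels alike, so
  vertices with equal \<open>lab\<close> are never told apart from outside.\<close>

lemma cw_constructible_imp_laminar:
  assumes "cw_constructible k G l"
  shows "(\<forall>e\<in>edges G. e \<subseteq> verts G) \<and> (\<forall>v\<in>verts G. l v < k) \<and>
    (\<exists>F. binary_laminar (verts G) F \<and> (\<forall>X\<in>F. cut_labelled k G l X))"
  using assms
proof induction
  case (vertex l v)
  then show ?case
    using binary_laminar_singleton[of v] by (auto intro!: cut_labelled_whole)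
next
  case (disjoint_union G l H l')
  let ?V = "verts G" and ?W = "verts H" and ?l = "\<lambda>v. if v \<in> verts G then l v else l' v"
  let ?U = "\<lparr>verts = ?V \<union> ?W, edges = edges G \<union> edges H\<rparr>"
  obtain F where F: "binary_laminar ?V F" "\<And>X. X \<in> F \<Longrightarrow> cut_labelled k G l X"
    using disjoint_union.IH(1) by blast
  obtain F' where F': "binary_laminar ?W F'" "\<And>X. X \<in> F' \<Longrightarrow> cut_labelled k H l' X"
    using disjoint_union.IH(2) by blast
  have eG: "e \<subseteq> ?V" if "e \<in> edges G" for e
    using disjoint_union.IH(1) that by blast
  have eH: "e \<subseteq> ?W" if "e \<in> edges H" for e
    using disjoint_union.IH(2) that by blast
  have lt: "?l v < k" if "v \<in> ?V \<union> ?W" for v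
    using that disjoint_union.IH by auto
  have e: "e \<subseteq> ?V \<union> ?W" if "e \<in> edges ?U" for e
    using that eG[of e] eH[of e] by auto
  have "cut_labelled k ?U ?l X" if X: "X \<in> insert (?V \<union> ?W) (F \<union> F')" for X
  proof -
    consider "X = ?V \<union> ?W" | "X \<in> F" | "X \<in> F'"
      using X by blast
    then show ?thesis
    proof cases
      case 1
      show ?thesis
        unfolding 1 by (rule cut_labelled_whole[OF lt e])
    next
      case 2
      then have XV: "X \<subseteq> ?V"
        using binary_laminarD(2)[OF F(1)] by blast
      have "{x, z} \<in> edges ?U \<longleftrightarrow> {x, z} \<in> edges G" if "x \<in> X" for x z
        using eH[of "{x, z}"] XV that disjoint_union.hyps(3) by auto
      then show ?thesis
        by (intro cut_labelled_cong[OF F(2)[OF 2]]) (use XV in auto)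
    next
      case 3
      then have XW: "X \<subseteq> ?W"
        using binary_laminarD(2)[OF F'(1)] by blast
      have "{x, z} \<in> edges ?U \<longleftrightarrow> {x, z} \<in> edges H" if "x \<in> X" for x z
        using eG[of "{x, z}"] XW that disjoint_union.hyps(3) by auto
      then show ?thesis
        by (intro cut_labelled_cong[OF F'(2)[OF 3]]) (use XW disjoint_union.hyps(3) in auto)
    qed
  qed
  moreover have "binary_laminar (verts ?U) (insert (?V \<union> ?W) (F \<union> F'))"
    using binary_laminar_union[OF F(1) F'(1) disjoint_union.hyps(3)] by simp
  ultimately show ?case
    using lt e by auto
next
  case (join G l i j)
  let ?J = "{{x, y} |x y. x \<in> verts G \<and> y \<in> verts G \<and> l x = i \<and> l y = j}"
  let ?U = "\<lparr>verts = verts G, edges = edges G \<union> ?J\<rparr>"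
  obtain F where F: "binary_laminar (verts G) F" "\<And>X. X \<in> F \<Longrightarrow> cut_labelled k G l X"
    using join.IH by blast
  have J: "{x, z} \<in> ?J \<longleftrightarrow> x \<in> verts G \<and> z \<in> verts G \<and> (l x = i \<and> l z = j \<or> l z = i \<and> l x = j)" for x z
    by (auto simp: doubleton_eq_iff)
  have U: "{x, z} \<in> edges ?U \<longleftrightarrow> {x, z} \<in> edges G \<or> {x, z} \<in> ?J" for x z
    by simp
  have "cut_labelled k ?U l X" if X: "X \<in> F" for X
  proof -
    have XV: "x \<in> verts G" if "x \<in> X" for x
      using X that binary_laminarD(2)[OF F(1)] by blast
    show ?thesis
      by (rule cut_labelled_cong[OF F(2)[OF X]]) (simp_all only: U J XV)
  qed
  moreover have "\<forall>e\<in>edges ?U. e \<subseteq> verts G"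
    using join.IH by auto
  ultimately show ?case
    using join.IH F(1) by auto
next
  case (relabel G l i j)
  obtain F where F: "binary_laminar (verts G) F" "\<And>X. X \<in> F \<Longrightarrow> cut_labelled k G l X"
    using relabel.IH by blast
  have "cut_labelled k G (\<lambda>v. if l v = i then j else l v) X" if "X \<in> F" for X
    by (rule cut_labelled_cong[OF F(2)[OF that]]) simp_all
  then show ?case
    using relabel.IH relabel.hyps F(1) by auto
qed

locale cut_decomposition =
  fixes G :: "'a ugraph" and F :: "'a set set" and k :: nat
  assumes simple: "simple_graph G"
    and laminar: "binary_laminar (verts G) F"
    and cut: "X \<in> F \<Longrightarrow> card (out_nbhds G X) \<le> k"

lemma cut_decomposition_exists:
  assumes "simple_graph G" "cw_constructible k G l"
  obtains F where "cut_decomposition G F k"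
proof -
  obtain F where F: "binary_laminar (verts G) F" and lab: "\<And>X. X \<in> F \<Longrightarrow> cut_labelled k G l X"
    using cw_constructible_imp_laminar[OF assms(2)] by blast
  have "card (out_nbhds G X) \<le> k" if X: "X \<in> F" for X
  proof -
    have "finite X"
      using X binary_laminarD(2)[OF F] assms(1) unfolding simple_graph_def by (meson finite_subset)
    obtain lab :: "'a \<Rightarrow> nat" where l: "\<forall>x\<in>X. lab x < k"
      "\<forall>x\<in>X. \<forall>y\<in>X. lab x = lab y \<longrightarrow>
        l x = l y \<and> (\<forall>z. z \<notin> X \<longrightarrow> {x, z} \<in> edges G \<longleftrightarrow> {y, z} \<in> edges G)"
      using lab[OF X] unfolding cut_labelled_def by (elim exE conjE)
    have "nbhd G x - X = nbhd G y - X" if "x \<in> X" "y \<in> X" "lab x = lab y" for x y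
    proof -
      have "\<forall>z. z \<notin> X \<longrightarrow> {x, z} \<in> edges G \<longleftrightarrow> {y, z} \<in> edges G"
        using l(2)[THEN bspec, OF that(1), THEN bspec, OF that(2)] that(3) by blast
      then show ?thesis
        by (auto simp: nbhd_def insert_commute)
    qed
    then have "card (out_nbhds G X) \<le> card (lab ` X)"
      unfolding out_nbhds_def by (intro card_image_le_factor[OF \<open>finite X\<close>])
    also have "\<dots> \<le> card {..<k}"
      using l(1) by (intro card_mono) auto
    finally show ?thesis
      by simp
  qed
  then show ?thesis
    using that F assms(1) unfolding cut_decomposition_def by blast
qed

lemma nbhd_iff: "u \<in> nbhd G v \<longleftrightarrow> {u, v} \<in> edges G"
  by (simp add: nbhd_def)

lemma nbhd_sym: "u \<in> nbhd G v \<longleftrightarrow> v \<in> nbhd G u"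
  by (simp add: nbhd_def insert_commute)

context cut_decomposition
begin

lemma finite_verts: "finite (verts G)"
  using simple unfolding simple_graph_def by simp

lemma verts_mem: "verts G \<in> F"
  using binary_laminarD(1)[OF laminar] by simp

lemma mem_subset: "X \<in> F \<Longrightarrow> X \<subseteq> verts G"
  using binary_laminarD(2)[OF laminar] by blast

lemma mem_nonempty: "X \<in> F \<Longrightarrow> X \<noteq> {}"
  using binary_laminarD(2)[OF laminar] by blast

lemma singleton_mem: "v \<in> verts G \<Longrightarrow> {v} \<in> F"
  using binary_laminarD(3)[OF laminar] by blast

lemma mem_cases:
  assumes "X \<in> F"
  obtains v where "X = {v}" | Y Z where "Y \<in> F" "Z \<in> F" "X = Y \<union> Z" "Y \<inter> Z = {}"
  using binary_laminarD(4)[OF laminar, THEN bspec, OF assms] by metis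

lemma nested_or_disjoint: "X \<in> F \<Longrightarrow> Y \<in> F \<Longrightarrow> X \<subseteq> Y \<or> Y \<subseteq> X \<or> X \<inter> Y = {}"
  using binary_laminarD(5)[OF laminar] by blast

lemma finite_mem: "X \<in> F \<Longrightarrow> finite X"
  using mem_subset finite_verts finite_subset by blast

lemma finite_family: "finite F"
  using mem_subset finite_verts by (meson PowI finite_Pow_iff finite_subset subsetI)

lemma verts_nonempty: "verts G \<noteq> {}"
  using mem_nonempty verts_mem by blast

lemma one_le_k: "1 \<le> k"
proof -
  have "out_nbhds G (verts G) \<noteq> {}" "finite (out_nbhds G (verts G))"
    using verts_nonempty finite_verts unfolding out_nbhds_def by auto
  then have "1 \<le> card (out_nbhds G (verts G))"
    by (simp add: Suc_leI card_gt_0_iff)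
  then show ?thesis
    using cut[OF verts_mem] by linarith
qed

subsection \<open>The merge sequence of a laminar decomposition\<close>

definition block :: "nat \<Rightarrow> 'a \<Rightarrow> 'a set" where
  "block t v = \<Union> {X \<in> F. v \<in> X \<and> card X \<le> t}"

text \<open>Members containing \<open>v\<close> form a chain, so the union defining
  \<open>block t v\<close> is the largest of those of size at most \<open>t\<close>;
  \<open>{v}\<close> shows that there is one.\<close>

lemma block_mem:
  assumes "1 \<le> t" "v \<in> verts G"
  shows "block t v \<in> F" "v \<in> block t v" "card (block t v) \<le> t"
proof -
  let ?A = "{X \<in> F. v \<in> X \<and> card X \<le> t}"
  have "{v} \<in> ?A"
    using singleton_mem assms by auto
  then have "?A \<noteq> {}" "finite ?A"
    using finite_family by auto
  from finite_has_maximal[OF this(2,1)]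
  obtain X where X: "X \<in> ?A" "\<And>Y. Y \<in> ?A \<Longrightarrow> X \<subseteq> Y \<Longrightarrow> X = Y"
    by blast
  have "Y \<subseteq> X" if "Y \<in> ?A" for Y
    using nested_or_disjoint[of X Y] X that by blast
  then have "block t v = X"
    using X(1) unfolding block_def by blast
  then show "block t v \<in> F" "v \<in> block t v" "card (block t v) \<le> t"
    using X(1) by auto
qed

lemma block_eq:
  assumes "1 \<le> t" "v \<in> verts G" "u \<in> block t v"
  shows "block t u = block t v"
proof -
  have u: "u \<in> verts G"
    using block_mem(1)[OF assms(1,2)] mem_subset assms(3) by blast
  have sub: "block t v \<subseteq> block t u"
    using block_mem[OF assms(1,2)] assms(3) unfolding block_def[of t u] by blast
  then have "v \<in> block t u"
    using block_mem(2)[OF assms(1,2)] by blast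
  then have "block t u \<subseteq> block t v"
    using block_mem[OF assms(1) u] unfolding block_def[of t v] by blast
  with sub show ?thesis
    by blast
qed

lemma block_mono: "s \<le> t \<Longrightarrow> block s v \<subseteq> block t v"
  unfolding block_def by auto

lemma block_one: "v \<in> verts G \<Longrightarrow> block 1 v = {v}"
  using block_mem[of 1 v] finite_mem[of "block 1 v"]
  by (metis One_nat_def card_le_Suc0_iff_eq insertI1 order_refl set_eqI singleton_iff)

lemma block_top: "v \<in> verts G \<Longrightarrow> block (card (verts G)) v = verts G"
  using verts_mem mem_subset unfolding block_def by blast

definition block_type :: "nat \<Rightarrow> 'a \<Rightarrow> 'a set \<times> 'a set" where
  "block_type t v = (block t v, nbhd G v - block t v)"

definition type_partition :: "nat \<Rightarrow> 'a set set" where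
  "type_partition t = fibres (verts G) (block_type t)"

lemma partition_chain_types: "partition_chain (verts G) (card (verts G)) type_partition"
  unfolding partition_chain_def type_partition_def
proof (intro conjI ballI partition_on_fibres)
  show "1 \<le> card (verts G)"
    using verts_nonempty finite_verts by (simp add: Suc_leI card_gt_0_iff)
  show "fibres (verts G) (block_type 1) = (\<lambda>v. {v}) ` verts G"
    by (rule fibres_inj_on, rule inj_onI) (simp add: block_type_def block_one[unfolded One_nat_def])
  show "fibres (verts G) (block_type (card (verts G))) = {verts G} - {{}}"
  proof (rule fibres_const)
    have "nbhd G v - verts G = {}" for v
      using simple_graph_edge(1)[OF simple] unfolding nbhd_def by blast
    then show "block_type (card (verts G)) x = block_type (card (verts G)) y"
      if "x \<in> verts G" "y \<in> verts G" for x y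
      using that by (simp only: block_type_def block_top)
  qed
  show "refines (verts G) (fibres (verts G) (block_type t)) (fibres (verts G) (block_type (t + 1)))"
    if t: "t \<in> {1..<card (verts G)}" for t
  proof (rule refines_fibres)
    fix x y assume xy: "x \<in> verts G" "y \<in> verts G" and eq: "block_type t x = block_type t y"
    have t1: "1 \<le> t" "1 \<le> t + 1"
      using t by auto
    have "y \<in> block t x"
      using eq block_mem(2)[OF t1(1) xy(2)] unfolding block_type_def by auto
    then have "y \<in> block (t + 1) x"
      using block_mono[of t "t + 1" x] by auto
    from block_eq[OF t1(2) xy(1) this] have b: "block (t + 1) y = block (t + 1) x" .
    have "nbhd G x - block (t + 1) x = (nbhd G x - block t x) - block (t + 1) x"
      using block_mono[of t "t + 1" x] by auto
    also have "nbhd G x - block t x = nbhd G y - block t y"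
      using eq unfolding block_type_def by blast
    also have "(nbhd G y - block t y) - block (t + 1) x = nbhd G y - block (t + 1) y"
      using block_mono[of t "t + 1" y] b by auto
    finally show "block_type (t + 1) x = block_type (t + 1) y"
      using b unfolding block_type_def by blast
  qed
qed

text \<open>The ends are exchanged one at a time: \<open>y\<close> lies outside the common block of
  \<open>x\<close> and \<open>x'\<close>, and then \<open>x'\<close> outside the common block of
  \<open>y\<close> and \<open>y'\<close>.\<close>

lemma block_type_homogeneous:
  assumes "1 \<le> t" "x \<in> verts G" "x' \<in> verts G" "y \<in> verts G" "y' \<in> verts G"
    and eq: "block_type t x = block_type t x'" "block_type t y = block_type t y'"
    and ne: "block t x \<noteq> block t y" and e: "{x, y} \<in> edges G"
  shows "{x', y'} \<in> edges G"
proof -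
  have x: "block t x = block t x'" "nbhd G x - block t x = nbhd G x' - block t x'"
    and y: "block t y = block t y'" "nbhd G y - block t y = nbhd G y' - block t y'"
    using eq unfolding block_type_def by blast+
  have "y \<notin> block t x"
    using block_eq[OF assms(1,2)] ne by blast
  moreover have "y \<in> nbhd G x"
    using e by (simp add: nbhd_def insert_commute)
  ultimately have "y \<in> nbhd G x'"
    using x(2) by blast
  then have "x' \<in> nbhd G y"
    by (simp add: nbhd_def insert_commute)
  moreover have "x' \<notin> block t y"
    using block_eq[OF assms(1,4), of x'] ne x(1) by metis
  ultimately have "x' \<in> nbhd G y'"
    using y(2) by blast
  then show ?thesis
    by (simp add: nbhd_def)
qed

text \<open>A member of size at most \<open>t + 1\<close> is a singleton or the disjoint union of
  two nonempty members of size at most \<open>t\<close>. Each of these lies in one block of level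
  \<open>t\<close>, which has at most \<open>k\<close> types.\<close>

lemma card_block_types_le:
  assumes t: "1 \<le> t" and v: "v \<in> verts G"
  shows "card (parts_meeting (block (t + 1) v) (type_partition t)) \<le> 2 * k"
proof -
  let ?X = "block (t + 1) v"
  have X: "?X \<in> F" "card ?X \<le> t + 1" "?X \<subseteq> verts G"
    using block_mem[of "t + 1" v] v mem_subset by auto
  have half: "card (block_type t ` Y) \<le> k" if Y: "Y \<in> F" "card Y \<le> t" for Y
  proof -
    obtain y where y: "y \<in> Y"
      using mem_nonempty[OF Y(1)] by blast
    then have yV: "y \<in> verts G"
      using mem_subset[OF Y(1)] by blast
    let ?Z = "block t y"
    have Z: "Y \<subseteq> ?Z"
      using Y y unfolding block_def by blast
    have "block_type t ` Y \<subseteq> Pair ?Z ` out_nbhds G ?Z"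
    proof
      fix a assume "a \<in> block_type t ` Y"
      then obtain x where x: "x \<in> Y" "a = block_type t x"
        by blast
      then have "block t x = ?Z"
        using block_eq[OF t yV] Z by blast
      then show "a \<in> Pair ?Z ` out_nbhds G ?Z"
        using x Z unfolding block_type_def out_nbhds_def by auto
    qed
    moreover have fin: "finite (out_nbhds G ?Z)"
      using finite_mem[OF block_mem(1)[OF t yV]] unfolding out_nbhds_def by simp
    ultimately have "card (block_type t ` Y) \<le> card (Pair ?Z ` out_nbhds G ?Z)"
      by (intro card_mono) auto
    also have "\<dots> \<le> card (out_nbhds G ?Z)"
      using fin by (rule card_image_le)
    finally show ?thesis
      using cut[OF block_mem(1)[OF t yV]] by linarith
  qed
  have "card (block_type t ` ?X) \<le> 2 * k"
    using X(1)
  proof (cases rule: mem_cases)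
    case (1 u)
    then show ?thesis
      using one_le_k by simp
  next
    case (2 Y Z)
    have fin: "finite Y" "finite Z"
      using finite_mem 2 by auto
    have "card Y + card Z \<le> t + 1"
      using X(2) 2 fin card_Un_disjoint[of Y Z] by simp
    moreover have "1 \<le> card Y" "1 \<le> card Z"
      using fin 2(1,2) mem_nonempty by (simp_all add: Suc_leI card_gt_0_iff)
    ultimately have "card (block_type t ` Y) \<le> k" "card (block_type t ` Z) \<le> k"
      using half 2 by auto
    then show ?thesis
      using card_Un_le[of "block_type t ` Y" "block_type t ` Z"] 2(3) by (simp add: image_Un)
  qed
  then show ?thesis
    unfolding type_partition_def card_parts_meeting_fibres[OF X(3) finite_verts] .
qed

lemma card_ball_types_le:
  assumes t: "1 \<le> t" and v: "v \<in> verts G" and H: "verts H = verts G"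
    and mono: "\<And>x y. {x, y} \<in> edges H \<Longrightarrow> block (t + 1) x = block (t + 1) y"
  shows "card (parts_meeting (graph_ball H \<infinity> v) (type_partition t)) \<le> 2 * k"
proof -
  have "graph_ball H \<infinity> v \<subseteq> {u \<in> verts G. block (t + 1) u = block (t + 1) v}"
    using graph_ball_monochromatic[of H "block (t + 1)" v, OF mono] H by blast
  also have "\<dots> \<subseteq> block (t + 1) v"
    using block_mem(2)[of "t + 1"] by auto
  finally have "card (parts_meeting (graph_ball H \<infinity> v) (type_partition t)) \<le>
      card (parts_meeting (block (t + 1) v) (type_partition t))"
    by (rule card_parts_meeting_mono)
      (use finite_elements[OF finite_verts partition_on_fibres] in \<open>simp add: type_partition_def\<close>)
  then show ?thesis
    using card_block_types_le[OF t v] by linarith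
qed

lemma mw_le: "mw \<infinity> G \<le> enat (2 * k)"
proof -
  \<comment> \<open>The red pairs are the pairs inside a block, so homogeneity only has to be shown
    between different blocks.\<close>
  define R where "R t = {{x, y} |x y. x \<in> verts G \<and> y \<in> verts G \<and> x \<noteq> y \<and> block t x = block t y}" for t
  have R: "{x, y} \<in> R t \<longleftrightarrow> x \<in> verts G \<and> y \<in> verts G \<and> x \<noteq> y \<and> block t x = block t y" for x y t
    unfolding R_def by (auto simp: doubleton_eq_iff)
  have ms: "merge_sequence G (card (verts G)) type_partition R"
    unfolding merge_sequence_def
  proof (intro conjI ballI partition_chain_types)
    show "R t \<subseteq> R (t + 1)" if "t \<in> {1..<card (verts G)}" for t
    proof
      fix e assume "e \<in> R t"
      then obtain x y where e: "e = {x, y}" "x \<in> verts G" "y \<in> verts G" "x \<noteq> y" "block t x = block t y"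
        unfolding R_def by blast
      have "y \<in> block (t + 1) x"
        using block_mem(2)[of t y] e that block_mono[of t "t + 1" x] by auto
      then have "block (t + 1) y = block (t + 1) x"
        using e by (intro block_eq) auto
      then show "e \<in> R (t + 1)"
        using e R by simp
    qed
    show "R t \<subseteq> [verts G]\<^bsup>2\<^esup>" for t
      unfolding R_def by auto
    show "homogeneous_mod G (type_partition t) (R t)" if t: "t \<in> {1..card (verts G)}" for t
      unfolding homogeneous_mod_def
    proof (intro ballI)
      fix X Y assume XY: "X \<in> type_partition t" "Y \<in> type_partition t"
      have fib: "u \<in> verts G" "block_type t u = block_type t v" if "Z \<in> type_partition t" "u \<in> Z" "v \<in> Z" for Z u v
        using that unfolding type_partition_def fibres_def by auto
      have step: "{x', y'} \<in> edges G"
        if xy: "x \<in> X" "y \<in> Y" "x' \<in> X" "y' \<in> Y" "{x, y} \<in> edges G" "x \<noteq> y" "{x, y} \<notin> R t" for x y x' y'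
      proof -
        note V = fib(1)[OF XY(1) xy(1,1)] fib(1)[OF XY(1) xy(3,3)] fib(1)[OF XY(2) xy(2,2)] fib(1)[OF XY(2) xy(4,4)]
        have "block t x \<noteq> block t y"
          using xy(6,7) V unfolding R by blast
        from block_type_homogeneous[OF _ V fib(2)[OF XY(1) xy(1,3)] fib(2)[OF XY(2) xy(2,4)] this xy(5)]
        show ?thesis
          using t by simp
      qed
      show "(\<forall>x\<in>X. \<forall>y\<in>Y. x \<noteq> y \<and> {x, y} \<notin> R t \<longrightarrow> {x, y} \<in> edges G) \<or>
          (\<forall>x\<in>X. \<forall>y\<in>Y. x \<noteq> y \<and> {x, y} \<notin> R t \<longrightarrow> {x, y} \<notin> edges G)"
        using step by blast
    qed
  qed
  have "merge_sequence_width \<infinity> G (card (verts G)) type_partition R \<le> enat (2 * k)"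
    unfolding merge_sequence_width_def
  proof (intro SUP_least)
    fix t v assume "t \<in> {1..<card (verts G)}" "v \<in> verts G"
    then have "card (parts_meeting (graph_ball \<lparr>verts = verts G, edges = R (t + 1)\<rparr> \<infinity> v) (type_partition t)) \<le> 2 * k"
      by (intro card_ball_types_le) (auto simp: R)
    then show "enat (card (parts_meeting (graph_ball \<lparr>verts = verts G, edges = R (t + 1)\<rparr> \<infinity> v) (type_partition t))) \<le> enat (2 * k)"
      by simp
  qed
  then show ?thesis
    unfolding mw_def using ms by (intro Inf_lower2) blast+
qed

lemma tmw_le: "tmw \<infinity> G \<le> enat (2 * k)"
proof -
  have "\<exists>H. H \<in> flips G (type_partition t) \<and> (\<forall>x y. {x, y} \<in> edges H \<longrightarrow> block t x = block t y)"
    if "t \<in> {1..card (verts G)}" for t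
  proof -
    have t: "1 \<le> t"
      using that by simp
    obtain H where "H \<in> flips G (fibres (verts G) (block_type t))"
      "\<And>x y. {x, y} \<in> edges H \<Longrightarrow> block t x = block t y"
    proof (rule flip_separating_colours[OF simple, of "block_type t" "block t"])
      fix x x' y y'
      assume "x \<in> verts G" "x' \<in> verts G" "y \<in> verts G" "y' \<in> verts G"
        "block_type t x = block_type t x'" "block_type t y = block_type t y'"
        "block t x \<noteq> block t y" "{x, y} \<in> edges G"
      then show "{x', y'} \<in> edges G"
        by (rule block_type_homogeneous[OF t])
    qed (rule that)
    then show ?thesis
      unfolding type_partition_def by blast
  qed
  then obtain H where H: "\<And>t. t \<in> {1..card (verts G)} \<Longrightarrow> H t \<in> flips G (type_partition t)"
    "\<And>t x y. t \<in> {1..card (verts G)} \<Longrightarrow> {x, y} \<in> edges (H t) \<Longrightarrow> block t x = block t y"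
    by metis
  have "card (parts_meeting (graph_ball (H (t + 1)) \<infinity> v) (type_partition t)) \<le> 2 * k"
    if "t \<in> {1..<card (verts G)}" "v \<in> verts G" for t v
  proof (rule card_ball_types_le)
    show "verts (H (t + 1)) = verts G"
      using H(1)[of "t + 1"] that unfolding flips_def flip_by_def by auto
  qed (use that H(2)[of "t + 1"] in auto)
  then show ?thesis
    unfolding tmw_def using partition_chain_types H(1) by (intro Inf_lower) blast
qed

end

lemma representatives:
  assumes "finite A"
  shows "\<exists>S. S \<subseteq> A \<and> card S \<le> card (f ` A) \<and> (\<forall>a\<in>A. \<exists>s\<in>S. f s = f a)"
proof (intro exI[of _ "inv_into A f ` f ` A"] conjI ballI)
  show "inv_into A f ` f ` A \<subseteq> A"
    by (auto simp: inv_into_into)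
  show "card (inv_into A f ` f ` A) \<le> card (f ` A)"
    using assms by (intro card_image_le) simp
  show "\<exists>s\<in>inv_into A f ` f ` A. f s = f a" if "a \<in> A" for a
    using that by (intro bexI[of _ "inv_into A f (f a)"]) (auto simp: f_inv_into_f)
qed

subsection \<open>Small separating sets\<close>

text \<open>Being a product, this set is empty iff one factor is, which is the duality sought; and
  two surviving pairs can be recombined into a third.\<close>

definition surviving_pairs :: "'a ugraph \<Rightarrow> 'a set \<Rightarrow> 'a set \<Rightarrow> 'a set \<Rightarrow> ('a \<times> 'a) set" where
  "surviving_pairs G U W S =
     {u \<in> U. \<forall>s\<in>S \<inter> W. s \<in> nbhd G u} \<times> {v \<in> W. \<forall>s\<in>S \<inter> U. s \<notin> nbhd G v}"

lemma surviving_pairs_mono: "S \<subseteq> S' \<Longrightarrow> surviving_pairs G U W S' \<subseteq> surviving_pairs G U W S"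
  unfolding surviving_pairs_def by blast

definition cut_cost :: "nat \<Rightarrow> nat" where
  "cut_cost k = 2 * (k + 2 ^ k)"

context cut_decomposition
begin

text \<open>An outside vertex is adjacent to exactly those vertices of \<open>X\<close> whose
  external neighbourhood contains it; its trace is thus coded by a subset of
  \<open>out_nbhds G X\<close>.\<close>

lemma card_traces_le:
  assumes "X \<in> F"
  shows "card ((\<lambda>u. nbhd G u \<inter> X) ` (verts G - X)) \<le> 2 ^ k"
proof -
  let ?g = "\<lambda>u. {N \<in> out_nbhds G X. u \<in> N}"
  have fin: "finite (out_nbhds G X)"
    using finite_mem[OF assms] unfolding out_nbhds_def by simp
  have iff: "x \<in> nbhd G u \<longleftrightarrow> nbhd G x - X \<in> ?g u" if "x \<in> X" "u \<notin> X" for x u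
    using that nbhd_sym[of x G u] unfolding out_nbhds_def by blast
  have "card ((\<lambda>u. nbhd G u \<inter> X) ` (verts G - X)) \<le> card (?g ` (verts G - X))"
  proof (rule card_image_le_factor)
    fix u v assume "u \<in> verts G - X" "v \<in> verts G - X" and eq: "?g u = ?g v"
    then have "x \<in> nbhd G u \<longleftrightarrow> x \<in> nbhd G v" if "x \<in> X" for x
      using iff[OF that] by (metis (no_types, lifting) DiffD2)
    then show "nbhd G u \<inter> X = nbhd G v \<inter> X"
      by blast
  qed (use finite_verts in simp)
  also have "\<dots> \<le> card (Pow (out_nbhds G X))"
    using fin by (intro card_mono) auto
  also have "\<dots> \<le> 2 ^ k"
    using cut[OF assms] fin by (simp add: card_Pow)
  finally show ?thesis .
qed

text \<open>\<open>S\<close> takes representatives of \<open>U\<close> and of \<open>W\<close> on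
  both sides of the cut: \<open>k\<close> external neighbourhoods inside, \<open>2 ^ k\<close>
  traces outside, each twice, hence \<open>cut_cost k\<close>. In a surviving crossing pair
  \<open>(u, v)\<close> the representative of \<open>u\<close> forces a non-edge and that of
  \<open>v\<close> an edge.\<close>

lemma cut_separator:
  assumes "X \<in> F" "U \<subseteq> verts G" "W \<subseteq> verts G"
  shows "\<exists>S. S \<subseteq> U \<union> W \<and> card S \<le> cut_cost k \<and>
    (surviving_pairs G U W S \<subseteq> X \<times> X \<or> surviving_pairs G U W S \<subseteq> (- X) \<times> (- X))"
proof -
  let ?o = "\<lambda>x. nbhd G x - X" and ?i = "\<lambda>x. nbhd G x \<inter> X"
  have inner: "\<exists>S. S \<subseteq> A \<inter> X \<and> card S \<le> k \<and> (\<forall>a\<in>A \<inter> X. \<exists>s\<in>S. ?o s = ?o a)" for A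
  proof -
    have fin: "finite (A \<inter> X)"
      using finite_mem[OF assms(1)] by simp
    obtain S where S: "S \<subseteq> A \<inter> X" "card S \<le> card (?o ` (A \<inter> X))" "\<forall>a\<in>A \<inter> X. \<exists>s\<in>S. ?o s = ?o a"
      using representatives[OF fin, of ?o] by (elim exE conjE)
    have "card (?o ` (A \<inter> X)) \<le> card (out_nbhds G X)"
      using finite_mem[OF assms(1)] unfolding out_nbhds_def by (intro card_mono) auto
    then show ?thesis
      using S cut[OF assms(1)] by (intro exI[of _ S] conjI) simp_all
  qed
  have outer: "\<exists>S. S \<subseteq> A - X \<and> card S \<le> 2 ^ k \<and> (\<forall>a\<in>A - X. \<exists>s\<in>S. ?i s = ?i a)" if A: "A \<subseteq> verts G" for A
  proof -
    have fin: "finite (A - X)"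
      using finite_subset[OF A finite_verts] by simp
    obtain S where S: "S \<subseteq> A - X" "card S \<le> card (?i ` (A - X))" "\<forall>a\<in>A - X. \<exists>s\<in>S. ?i s = ?i a"
      using representatives[OF fin, of ?i] by (elim exE conjE)
    have "card (?i ` (A - X)) \<le> card (?i ` (verts G - X))"
      using finite_verts A by (intro card_mono) auto
    then show ?thesis
      using S card_traces_le[OF assms(1)] by (intro exI[of _ S] conjI) simp_all
  qed
  obtain S1 where S1: "S1 \<subseteq> U \<inter> X" "card S1 \<le> k" "\<forall>a\<in>U \<inter> X. \<exists>s\<in>S1. ?o s = ?o a"
    using inner[of U] by (elim exE conjE)
  obtain S2 where S2: "S2 \<subseteq> W \<inter> X" "card S2 \<le> k" "\<forall>a\<in>W \<inter> X. \<exists>s\<in>S2. ?o s = ?o a"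
    using inner[of W] by (elim exE conjE)
  obtain S3 where S3: "S3 \<subseteq> U - X" "card S3 \<le> 2 ^ k" "\<forall>a\<in>U - X. \<exists>s\<in>S3. ?i s = ?i a"
    using outer[OF assms(2)] by (elim exE conjE)
  obtain S4 where S4: "S4 \<subseteq> W - X" "card S4 \<le> 2 ^ k" "\<forall>a\<in>W - X. \<exists>s\<in>S4. ?i s = ?i a"
    using outer[OF assms(3)] by (elim exE conjE)
  define S where "S = S1 \<union> S2 \<union> S3 \<union> S4"
  have no1: False if uv: "(u, v) \<in> surviving_pairs G U W S" "u \<in> X" "v \<notin> X" for u v
  proof -
    have u: "u \<in> U" "\<And>s. s \<in> S \<inter> W \<Longrightarrow> s \<in> nbhd G u" and v: "v \<in> W" "\<And>s. s \<in> S \<inter> U \<Longrightarrow> s \<notin> nbhd G v"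
      using uv(1) unfolding surviving_pairs_def by blast+
    obtain s where s: "s \<in> S1" "?o s = ?o u"
      using S1(3)[THEN bspec, of u] u(1) uv(2) by blast
    have "s \<notin> nbhd G v"
      using v(2)[of s] s(1) S1(1) unfolding S_def by blast
    then have "v \<notin> nbhd G s"
      using nbhd_sym by metis
    then have "v \<notin> nbhd G u"
      using s(2) uv(3) by blast
    obtain s' where s': "s' \<in> S4" "?i s' = ?i v"
      using S4(3)[THEN bspec, of v] v(1) uv(3) by blast
    have "s' \<in> nbhd G u"
      using u(2)[of s'] s'(1) S4(1) unfolding S_def by blast
    then have "u \<in> nbhd G s'"
      using nbhd_sym by metis
    then have "u \<in> nbhd G v"
      using s'(2) uv(2) by blast
    then show False
      using \<open>v \<notin> nbhd G u\<close> nbhd_sym by metis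
  qed
  have no2: False if uv: "(u, v) \<in> surviving_pairs G U W S" "u \<notin> X" "v \<in> X" for u v
  proof -
    have u: "u \<in> U" "\<And>s. s \<in> S \<inter> W \<Longrightarrow> s \<in> nbhd G u" and v: "v \<in> W" "\<And>s. s \<in> S \<inter> U \<Longrightarrow> s \<notin> nbhd G v"
      using uv(1) unfolding surviving_pairs_def by blast+
    obtain s where s: "s \<in> S3" "?i s = ?i u"
      using S3(3)[THEN bspec, of u] u(1) uv(2) by blast
    have "s \<notin> nbhd G v"
      using v(2)[of s] s(1) S3(1) unfolding S_def by blast
    then have "v \<notin> nbhd G s"
      using nbhd_sym by metis
    then have "v \<notin> nbhd G u"
      using s(2) uv(3) by blast
    obtain s' where s': "s' \<in> S2" "?o s' = ?o v"
      using S2(3)[THEN bspec, of v] v(1) uv(3) by blast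
    have "s' \<in> nbhd G u"
      using u(2)[of s'] s'(1) S2(1) unfolding S_def by blast
    then have "u \<in> nbhd G s'"
      using nbhd_sym by metis
    then have "u \<in> nbhd G v"
      using s'(2) uv(2) by blast
    then show False
      using \<open>v \<notin> nbhd G u\<close> nbhd_sym by metis
  qed
  have "surviving_pairs G U W S \<subseteq> X \<times> X \<or> surviving_pairs G U W S \<subseteq> (- X) \<times> (- X)"
  proof (rule ccontr)
    assume no: "\<not> ?thesis"
    then obtain u v where uv: "(u, v) \<in> surviving_pairs G U W S" "(u, v) \<notin> X \<times> X"
      by auto
    obtain u' v' where uv': "(u', v') \<in> surviving_pairs G U W S" "(u', v') \<notin> (- X) \<times> (- X)"
      using no by auto
    have "u \<notin> X" "v' \<in> X"
      using no1[OF uv(1)] no1[OF uv'(1)] uv(2) uv'(2) by blast+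
    \<comment> \<open>The product structure recombines the two pairs into a crossing one.\<close>
    have "(u, v') \<in> surviving_pairs G U W S"
      using uv(1) uv'(1) unfolding surviving_pairs_def by blast
    then show False
      using no2 \<open>u \<notin> X\<close> \<open>v' \<in> X\<close> by blast
  qed
  moreover have "S \<subseteq> U \<union> W"
    using S1(1) S2(1) S3(1) S4(1) unfolding S_def by blast
  moreover have "card S \<le> cut_cost k"
  proof -
    have "card S \<le> card S1 + card S2 + card S3 + card S4"
      using card_Un_le[of "S1 \<union> S2 \<union> S3" S4] card_Un_le[of "S1 \<union> S2" S3] card_Un_le[of S1 S2]
      unfolding S_def by linarith
    also have "\<dots> \<le> k + k + 2 ^ k + 2 ^ k"
      by (intro add_mono S1(2) S2(2) S3(2) S4(2))
    finally show ?thesis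
      unfolding cut_cost_def by simp
  qed
  ultimately show ?thesis
    by blast
qed

text \<open>
  Each member \<open>X\<close> of the family pushes the surviving pairs to one side of the cut
  \<open>(X, - X)\<close>. At a minimal \<open>X\<close> that attracts them, the three cuts around \<open>X\<close> leave nothing.
\<close>

lemma separator_exists:
  assumes "U \<subseteq> verts G" "W \<subseteq> verts G"
  obtains S where "S \<subseteq> U \<union> W" "card S \<le> 3 * cut_cost k" "surviving_pairs G U W S = {}"
proof -
  let ?s = "surviving_pairs G U W"
  have "\<forall>X\<in>F. \<exists>S. S \<subseteq> U \<union> W \<and> card S \<le> cut_cost k \<and> (?s S \<subseteq> X \<times> X \<or> ?s S \<subseteq> (- X) \<times> (- X))"
    by (intro ballI cut_separator assms)
  from bchoice[OF this] obtain \<sigma> where \<sigma>0: "\<forall>X\<in>F. \<sigma> X \<subseteq> U \<union> W \<and> card (\<sigma> X) \<le> cut_cost k \<and>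
    (?s (\<sigma> X) \<subseteq> X \<times> X \<or> ?s (\<sigma> X) \<subseteq> (- X) \<times> (- X))"
    by (elim exE)
  note \<sigma> = \<sigma>0[THEN bspec, THEN conjunct1] \<sigma>0[THEN bspec, THEN conjunct2, THEN conjunct1]
    \<sigma>0[THEN bspec, THEN conjunct2, THEN conjunct2]
  let ?big = "{X \<in> F. ?s (\<sigma> X) \<subseteq> X \<times> X}"
  have "?s S \<subseteq> verts G \<times> verts G" for S
    using assms unfolding surviving_pairs_def by blast
  then have "?big \<noteq> {}" "finite ?big"
    using verts_mem finite_family by auto
  from finite_has_minimal[OF this(2,1)]
  obtain X where Xbig: "X \<in> ?big" and min: "\<forall>Y\<in>?big. Y \<subseteq> X \<longrightarrow> X = Y"
    by (elim bexE)
  from Xbig have X: "X \<in> F" "?s (\<sigma> X) \<subseteq> X \<times> X"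
    by simp_all
  from X(1) show ?thesis
  proof (cases rule: mem_cases)
    case (1 x)
    show ?thesis
    proof (cases "?s (\<sigma> X) = {}")
      case True
      then show ?thesis
        using that[of "\<sigma> X"] \<sigma>(1,2)[OF X(1)] by simp
    next
      case False
      then have "(x, x) \<in> ?s (\<sigma> X)"
        using X(2) 1 by auto
      then have x: "x \<in> U" "x \<in> W"
        unfolding surviving_pairs_def by blast+
      have "x \<notin> nbhd G x"
        using simple_graph_edge(3)[OF simple, of x x] unfolding nbhd_iff by blast
      \<comment> \<open>Adding \<open>x\<close> itself removes the last pair, for \<open>x\<close>
        would have to be adjacent to itself.\<close>
      then have "(x, x) \<notin> ?s (insert x (\<sigma> X))"
        using x unfolding surviving_pairs_def by blast
      moreover have "?s (insert x (\<sigma> X)) \<subseteq> {(x, x)}"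
        using surviving_pairs_mono[of "\<sigma> X" "insert x (\<sigma> X)" G U W] X(2) 1 by blast
      ultimately have "?s (insert x (\<sigma> X)) = {}"
        by blast
      moreover have "card (insert x (\<sigma> X)) \<le> 3 * cut_cost k"
      proof -
        have "card (insert x (\<sigma> X)) \<le> Suc (card (\<sigma> X))"
          by (rule card_insert_le_m1) simp_all
        also have "\<dots> \<le> 3 * cut_cost k"
        proof -
          have "1 \<le> cut_cost k"
            using one_le_k unfolding cut_cost_def by simp
          then show ?thesis
            using \<sigma>(2)[OF X(1)] by linarith
        qed
        finally show ?thesis .
      qed
      ultimately show ?thesis
        using that[of "insert x (\<sigma> X)"] \<sigma>(1)[OF X(1)] x by blast
    qed
  next
    case (2 Y Z)
    have "Y \<noteq> X" "Z \<noteq> X"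
      using 2 mem_nonempty by blast+
    then have "Y \<notin> ?big" "Z \<notin> ?big"
      using min[THEN bspec, of Y] min[THEN bspec, of Z] 2(3) by blast+
    then have YZ: "?s (\<sigma> Y) \<subseteq> (- Y) \<times> (- Y)" "?s (\<sigma> Z) \<subseteq> (- Z) \<times> (- Z)"
      using \<sigma>(3)[OF 2(1)] \<sigma>(3)[OF 2(2)] 2(1,2) by blast+
    let ?S = "\<sigma> X \<union> \<sigma> Y \<union> \<sigma> Z"
    have "?s ?S \<subseteq> ?s (\<sigma> X)" "?s ?S \<subseteq> ?s (\<sigma> Y)" "?s ?S \<subseteq> ?s (\<sigma> Z)"
      by (rule surviving_pairs_mono; blast)+
    then have "?s ?S = {}"
      using X(2) YZ 2(3) by blast
    moreover have "card ?S \<le> 3 * cut_cost k"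
      using card_Un_le[of "\<sigma> X \<union> \<sigma> Y" "\<sigma> Z"] card_Un_le[of "\<sigma> X" "\<sigma> Y"]
        \<sigma>(2)[OF X(1)] \<sigma>(2)[OF 2(1)] \<sigma>(2)[OF 2(2)] by linarith
    moreover have "?S \<subseteq> U \<union> W"
      using \<sigma>(1) X(1) 2(1,2) by blast
    ultimately show ?thesis
      using that by blast
  qed
qed

end

section \<open>Sets that resolve a piece\<close>

text \<open>
  If \<open>S\<close> resolves \<open>Z\<close>, then \<open>S \<inter> Z\<close> contains a representative of every external neighbourhood of
  \<open>Z\<close> (take \<open>u = v\<close>). Moreover two vertices outside \<open>Z\<close> with the atomic types of \<open>u\<close> and \<open>v\<close>
  cannot be joined to \<open>v\<close> and not joined to \<open>u\<close>, respectively; this is the one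
  configuration in which adjacency between atomic types would depend on the side of the cut.
\<close>

definition resolves :: "'a ugraph \<Rightarrow> 'a set \<Rightarrow> 'a set \<Rightarrow> bool" where
  "resolves G S Z \<longleftrightarrow> (\<forall>u\<in>Z - S. \<forall>v\<in>Z - S.
     \<not> ((\<forall>s\<in>S \<inter> Z. nbhd G s - Z = nbhd G v - Z \<longrightarrow> s \<in> nbhd G u) \<and>
        (\<forall>s\<in>S \<inter> Z. nbhd G s - Z = nbhd G u - Z \<longrightarrow> s \<notin> nbhd G v)))"

lemma resolves_mono:
  assumes "resolves G S Z" "S \<subseteq> S'"
  shows "resolves G S' Z"
  unfolding resolves_def
proof (intro ballI notI, elim conjE)
  fix u v assume uv: "u \<in> Z - S'" "v \<in> Z - S'"
    and a: "\<forall>s\<in>S' \<inter> Z. nbhd G s - Z = nbhd G v - Z \<longrightarrow> s \<in> nbhd G u"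
    and b: "\<forall>s\<in>S' \<inter> Z. nbhd G s - Z = nbhd G u - Z \<longrightarrow> s \<notin> nbhd G v"
  have "u \<in> Z - S" "v \<in> Z - S"
    using uv assms(2) by blast+
  from assms(1)[unfolded resolves_def, THEN bspec, OF this(1), THEN bspec, OF this(2)]
  show False
    using a b assms(2) by (meson IntD1 IntD2 IntI subsetD)
qed

lemma resolves_representative:
  assumes "resolves G S Z" "v \<in> Z"
  obtains s where "s \<in> S \<inter> Z" "nbhd G s - Z = nbhd G v - Z"
proof (cases "v \<in> S")
  case False
  then have v: "v \<in> Z - S"
    using assms(2) by blast
  from assms(1)[unfolded resolves_def, THEN bspec, OF v, THEN bspec, OF v] show ?thesis
    using that by blast
qed (use assms(2) that in blast)

definition piece_types :: "nat \<Rightarrow> nat" where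
  "piece_types k = k * 2 ^ k"

definition resolver_size :: "nat \<Rightarrow> nat" where
  "resolver_size k = piece_types k * piece_types k * (3 * cut_cost k)"

context cut_decomposition
begin

text \<open>The duality is applied to each ordered pair of classes of vertices with a common
  external neighbourhood; \<open>resolver_size\<close> bounds the number of pairs times the cost of
  one separator.\<close>

lemma resolver_exists:
  assumes "Z \<subseteq> verts G" "card (out_nbhds G Z) \<le> piece_types k"
  obtains S where "S \<subseteq> Z" "card S \<le> resolver_size k" "resolves G S Z"
proof -
  let ?O = "out_nbhds G Z" and ?U = "\<lambda>N. {z \<in> Z. nbhd G z - Z = N}"
  have fin: "finite ?O"
    using finite_subset[OF assms(1) finite_verts] unfolding out_nbhds_def by simp
  have "\<forall>p. \<exists>S. S \<subseteq> Z \<and> card S \<le> 3 * cut_cost k \<and>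
      surviving_pairs G (?U (fst p)) (?U (snd p)) S = {}"
  proof
    fix p
    have sub: "?U (fst p) \<subseteq> verts G" "?U (snd p) \<subseteq> verts G"
      using assms(1) by auto
    obtain S where "S \<subseteq> ?U (fst p) \<union> ?U (snd p)" "card S \<le> 3 * cut_cost k"
      "surviving_pairs G (?U (fst p)) (?U (snd p)) S = {}"
      by (rule separator_exists[OF sub(1,2)])
    moreover from this(1) have "S \<subseteq> Z"
      by blast
    ultimately show "\<exists>S. S \<subseteq> Z \<and> card S \<le> 3 * cut_cost k \<and>
        surviving_pairs G (?U (fst p)) (?U (snd p)) S = {}"
      by (intro exI[of _ S] conjI)
  qed
  from choice[OF this] obtain \<sigma> where \<sigma>0: "\<forall>p. \<sigma> p \<subseteq> Z \<and> card (\<sigma> p) \<le> 3 * cut_cost k \<and>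
      surviving_pairs G (?U (fst p)) (?U (snd p)) (\<sigma> p) = {}"
    by (elim exE)
  note \<sigma> = \<sigma>0[THEN spec, THEN conjunct1] \<sigma>0[THEN spec, THEN conjunct2, THEN conjunct1]
    \<sigma>0[THEN spec, THEN conjunct2, THEN conjunct2]
  let ?S = "\<Union>p\<in>?O \<times> ?O. \<sigma> p"
  have "card ?S \<le> (\<Sum>p\<in>?O \<times> ?O. card (\<sigma> p))"
    using fin by (intro card_UN_le) simp
  also have "\<dots> \<le> (\<Sum>p\<in>?O \<times> ?O. 3 * cut_cost k)"
    by (intro sum_mono \<sigma>(2))
  also have "\<dots> = card ?O * card ?O * (3 * cut_cost k)"
    by (simp add: card_cartesian_product)
  also have "\<dots> \<le> resolver_size k"
    unfolding resolver_size_def using assms(2) by (intro mult_mono) auto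
  finally have card: "card ?S \<le> resolver_size k" .
  have "resolves G ?S Z"
    unfolding resolves_def
  proof (intro ballI notI, elim conjE)
    fix u v assume uv: "u \<in> Z - ?S" "v \<in> Z - ?S"
      and a: "\<forall>s\<in>?S \<inter> Z. nbhd G s - Z = nbhd G v - Z \<longrightarrow> s \<in> nbhd G u"
      and b: "\<forall>s\<in>?S \<inter> Z. nbhd G s - Z = nbhd G u - Z \<longrightarrow> s \<notin> nbhd G v"
    define N where "N = nbhd G u - Z"
    define M where "M = nbhd G v - Z"
    have "N \<in> ?O" "M \<in> ?O"
      using uv unfolding N_def M_def out_nbhds_def by blast+
    then have sub: "\<sigma> (N, M) \<subseteq> ?S"
      by blast
    have "(u, v) \<in> surviving_pairs G (?U N) (?U M) (\<sigma> (N, M))"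
      unfolding surviving_pairs_def
    proof (intro SigmaI CollectI conjI ballI)
      show "s \<in> nbhd G u" if "s \<in> \<sigma> (N, M) \<inter> ?U M" for s
        using a[THEN bspec, of s] that sub unfolding M_def by blast
      show "s \<notin> nbhd G v" if "s \<in> \<sigma> (N, M) \<inter> ?U N" for s
        using b[THEN bspec, of s] that sub unfolding N_def by blast
    qed (use uv in \<open>auto simp: N_def M_def\<close>)
    then show False
      using \<sigma>(3)[of "(N, M)"] by simp
  qed
  moreover have "?S \<subseteq> Z"
    using \<sigma>(1) by blast
  ultimately show ?thesis
    using that card by blast
qed

end

subsection \<open>Splitting pieces\<close>

lemma partition_on_Un:
  assumes "partition_on A P" "partition_on B Q" "A \<inter> B = {}"
  shows "partition_on (A \<union> B) (P \<union> Q)"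
proof (rule partition_onI)
  show "\<Union> (P \<union> Q) = A \<union> B"
    using partition_onD1[OF assms(1)] partition_onD1[OF assms(2)] by simp
  show "{} \<notin> P \<union> Q"
    using partition_onD3[OF assms(1)] partition_onD3[OF assms(2)] by simp
  have "disjnt X Y" if "X \<in> P" "Y \<in> Q" for X Y
  proof -
    have "X \<subseteq> A" "Y \<subseteq> B"
      using that partition_onD1[OF assms(1)] partition_onD1[OF assms(2)] by blast+
    then show ?thesis
      using assms(3) unfolding disjnt_def by blast
  qed
  then show "disjnt X Y" if "X \<in> P \<union> Q" "Y \<in> P \<union> Q" "X \<noteq> Y" for X Y
    using that partition_onD2[OF assms(1)] partition_onD2[OF assms(2)]
    unfolding pairwise_def by (metis UnE disjnt_sym)
qed

lemma partition_on_trivial: "partition_on A ({A} - {{}})"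
  by (cases "A = {}") (auto simp: partition_on_space partition_on_empty)

lemma partition_on_remove:
  assumes "partition_on A P" "X \<in> P"
  shows "partition_on (A - X) (P - {X})"
proof (rule partition_onI)
  have "disjnt X Y" if "Y \<in> P - {X}" for Y
    using partition_onD2[OF assms(1)] assms(2) that unfolding pairwise_def by blast
  then show "\<Union> (P - {X}) = A - X"
    using partition_onD1[OF assms(1)] assms(2) unfolding disjnt_def by blast
  show "disjnt Y Z" if "Y \<in> P - {X}" "Z \<in> P - {X}" "Y \<noteq> Z" for Y Z
    using partition_onD2[OF assms(1)] that unfolding pairwise_def by blast
  show "{} \<notin> P - {X}"
    using partition_onD3[OF assms(1)] by blast
qed

lemma partition_on_UN:
  assumes "partition_on A P" "\<And>X. X \<in> P \<Longrightarrow> partition_on X (f X)"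
  shows "partition_on A (\<Union>X\<in>P. f X)"
proof (rule partition_onI)
  have U: "\<Union> (f X) = X" if "X \<in> P" for X
    using partition_onD1[OF assms(2)[OF that]] by simp
  have "\<Union> (\<Union>X\<in>P. f X) = (\<Union>X\<in>P. \<Union> (f X))"
    by blast
  also have "\<dots> = A"
    using U partition_onD1[OF assms(1)] by simp
  finally show "\<Union> (\<Union>X\<in>P. f X) = A" .
  show "{} \<notin> (\<Union>X\<in>P. f X)"
    using partition_onD3[OF assms(2)] by blast
  fix Y Z assume YZ: "Y \<in> (\<Union>X\<in>P. f X)" "Z \<in> (\<Union>X\<in>P. f X)" "Y \<noteq> Z"
  then obtain X X' where X: "X \<in> P" "Y \<in> f X" "X' \<in> P" "Z \<in> f X'"
    by blast
  show "disjnt Y Z"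
  proof (cases "X = X'")
    case True
    then show ?thesis
      using partition_onD2[OF assms(2)[OF X(1)]] X YZ(3) unfolding pairwise_def by blast
  next
    case False
    then have "disjnt X X'"
      using partition_onD2[OF assms(1)] X unfolding pairwise_def by blast
    moreover have "Y \<subseteq> X" "Z \<subseteq> X'"
      using U[OF X(1)] U[OF X(3)] X by blast+
    ultimately show ?thesis
      unfolding disjnt_def by blast
  qed
qed

context cut_decomposition
begin

text \<open>In the tree picture a piece is the leaf set of a subtree with at most one subtree cut
  out; \<open>insert {} F\<close> includes the case without a hole.\<close>

definition piece :: "'a set \<Rightarrow> bool" where
  "piece Z \<longleftrightarrow> Z \<noteq> {} \<and> (\<exists>X\<in>F. \<exists>Y\<in>insert {} F. Y \<subseteq> X \<and> Z = X - Y)"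

lemma piece_diff: "X \<in> F \<Longrightarrow> Y \<in> F \<Longrightarrow> Y \<subseteq> X \<Longrightarrow> X - Y \<noteq> {} \<Longrightarrow> piece (X - Y)"
  unfolding piece_def by blast

lemma piece_mem: "X \<in> F \<Longrightarrow> piece X"
  unfolding piece_def using mem_nonempty by (metis Diff_empty empty_subsetI insertI1)

lemma piece_subset: "piece Z \<Longrightarrow> Z \<subseteq> verts G"
  unfolding piece_def using mem_subset by blast

text \<open>For \<open>X - Y\<close> an external neighbourhood consists of a part outside
  \<open>X\<close>, with at most \<open>k\<close> choices, and a trace on the hole \<open>Y\<close>,
  with at most \<open>2 ^ k\<close> choices.\<close>

lemma card_out_nbhds_piece:
  assumes "piece Z"
  shows "card (out_nbhds G Z) \<le> piece_types k"
proof -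
  obtain X Y where X: "X \<in> F" and Y: "Y \<in> insert {} F" "Y \<subseteq> X" and Z: "Z = X - Y"
    using assms unfolding piece_def by blast
  show ?thesis
  proof (cases "Y = {}")
    case True
    then have "card (out_nbhds G Z) \<le> k"
      using Z cut[OF X] by simp
    also have "k \<le> piece_types k"
      unfolding piece_types_def by simp
    finally show ?thesis .
  next
    case False
    then have YF: "Y \<in> F"
      using Y by blast
    let ?T = "(\<lambda>u. nbhd G u \<inter> Y) ` (verts G - Y)"
    have fin: "finite (out_nbhds G X)" "finite ?T"
      using finite_mem[OF X] finite_verts unfolding out_nbhds_def by auto
    have "out_nbhds G Z \<subseteq> (\<lambda>(A, B). A \<union> B) ` (out_nbhds G X \<times> ?T)"
    proof
      fix N assume "N \<in> out_nbhds G Z"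
      then obtain z where z: "z \<in> X" "z \<notin> Y" "N = nbhd G z - Z"
        unfolding out_nbhds_def Z by blast
      have "N = (nbhd G z - X) \<union> (nbhd G z \<inter> Y)"
        using z(3) Y(2) unfolding Z by blast
      moreover have "nbhd G z - X \<in> out_nbhds G X" "nbhd G z \<inter> Y \<in> ?T"
        using z(1,2) mem_subset[OF X] unfolding out_nbhds_def by blast+
      ultimately show "N \<in> (\<lambda>(A, B). A \<union> B) ` (out_nbhds G X \<times> ?T)"
        by blast
    qed
    then have "card (out_nbhds G Z) \<le> card (out_nbhds G X \<times> ?T)"
      using fin by (intro surj_card_le) auto
    also have "\<dots> \<le> piece_types k"
      unfolding card_cartesian_product piece_types_def
      using cut[OF X] card_traces_le[OF YF] by (rule mult_le_mono)
    finally show ?thesis .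
  qed
qed

text \<open>\<open>W\<close> is the lowest common ancestor of \<open>A\<close>; that
  \<open>T\<close> has two vertices keeps it from being a leaf. The set \<open>A\<close> is left
  free to serve both \<open>T\<close> itself and, for a piece with hole \<open>Y\<close>, the union
  \<open>T \<union> Y\<close>.\<close>

lemma minimal_member:
  assumes "X \<in> F" "T \<subseteq> X" "2 \<le> card T" "T \<subseteq> A" "A \<subseteq> X"
  obtains W Y Z where "W \<in> F" "A \<subseteq> W" "W \<subseteq> X" "Y \<in> F" "Z \<in> F" "W = Y \<union> Z" "Y \<inter> Z = {}"
    "\<not> A \<subseteq> Y" "\<not> A \<subseteq> Z"
proof -
  let ?B = "{W \<in> F. A \<subseteq> W \<and> W \<subseteq> X}"
  have "finite ?B" "?B \<noteq> {}"
    using finite_family assms(1,5) by auto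
  from finite_has_minimal[OF this] obtain W where WB: "W \<in> ?B" and min: "\<forall>W'\<in>?B. W' \<subseteq> W \<longrightarrow> W = W'"
    by (elim bexE)
  then have W: "W \<in> F" "A \<subseteq> W" "W \<subseteq> X"
    by auto
  from W(1) show ?thesis
  proof (cases rule: mem_cases)
    case (1 v)
    then have "T \<subseteq> {v}"
      using W(2) assms(4) by blast
    then have "card T \<le> 1"
      using card_mono[of "{v}" T] by simp
    then show ?thesis
      using assms(3) by simp
  next
    case (2 Y Z)
    have "Y \<noteq> W" "Z \<noteq> W"
      using 2 mem_nonempty by blast+
    then have "Y \<notin> ?B" "Z \<notin> ?B"
      using min[THEN bspec, of Y] min[THEN bspec, of Z] 2(3) by blast+
    then have "\<not> A \<subseteq> Y" "\<not> A \<subseteq> Z"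
      using 2(1-3) W(3) by blast+
    then show ?thesis
      using that[OF W 2] by blast
  qed
qed

lemma card_Int_less:
  assumes "2 \<le> card T" "\<not> T \<subseteq> A"
  shows "card (T \<inter> A) < card T"
proof -
  have "finite T"
    using assms(1) by (metis card.infinite not_numeral_le_zero)
  then show ?thesis
    using assms(2) by (intro psubset_card_mono) auto
qed

text \<open>Neither child of the lowest common ancestor \<open>W\<close> of \<open>T\<close>
  contains all of \<open>T\<close>, and \<open>X - W\<close> contains none of it.\<close>

lemma split_member:
  assumes "X \<in> F" "T \<subseteq> X" "2 \<le> card T"
  shows "\<exists>Q. partition_on X Q \<and> card Q \<le> 3 \<and> (\<forall>Z\<in>Q. piece Z \<and> card (T \<inter> Z) < card T)"
proof -
  obtain W Y Z where W: "W \<in> F" "T \<subseteq> W" "W \<subseteq> X" and YZ: "Y \<in> F" "Z \<in> F" "W = Y \<union> Z" "Y \<inter> Z = {}"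
    "\<not> T \<subseteq> Y" "\<not> T \<subseteq> Z"
    by (rule minimal_member[OF assms order_refl assms(2)])
  let ?Q = "({X - W} - {{}}) \<union> (({Y} - {{}}) \<union> ({Z} - {{}}))"
  have "partition_on ((X - W) \<union> (Y \<union> Z)) ?Q"
    using YZ(3,4) by (intro partition_on_Un partition_on_trivial) auto
  moreover have "(X - W) \<union> (Y \<union> Z) = X"
    using W(3) YZ(3) by blast
  moreover have "card ?Q \<le> card {X - W, Y, Z}"
    by (intro card_mono) auto
  moreover have "card {X - W, Y, Z} \<le> 3"
    by (simp add: card_insert_if)
  moreover have "piece A \<and> card (T \<inter> A) < card T" if "A \<in> ?Q" for A
  proof -
    consider "A = X - W" "X - W \<noteq> {}" | "A = Y" | "A = Z"
      using \<open>A \<in> ?Q\<close> by blast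
    then show ?thesis
    proof cases
      case 1
      then have "T \<inter> A = {}"
        using W(2) by blast
      then have "card (T \<inter> A) < card T"
        using assms(3) by simp
      then show ?thesis
        using piece_diff[OF assms(1) W(1,3) 1(2)] 1(1) by simp
    qed (use piece_mem[OF YZ(1)] piece_mem[OF YZ(2)] card_Int_less[OF assms(3)] YZ(5,6) in auto)
  qed
  ultimately show ?thesis
    by (intro exI[of _ ?Q]) auto
qed

text \<open>At the lowest common ancestor \<open>W\<close> of \<open>T\<close> and the hole
  \<open>Y\<close>, one child \<open>C\<close> contains \<open>Y\<close>. The parts are
  \<open>X - W\<close>, the holed child \<open>C - Y\<close> and the other child \<open>D\<close>.
  Only \<open>D\<close> may still contain all of \<open>T\<close>, and having no hole it can then be
  split into three: \<open>5 = 2 + 3\<close>.\<close>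

lemma split_difference:
  assumes X: "X \<in> F" and Y: "Y \<in> F" "Y \<subseteq> X" and T: "T \<subseteq> X - Y" "2 \<le> card T"
  shows "\<exists>Q. partition_on (X - Y) Q \<and> card Q \<le> 5 \<and> (\<forall>Z\<in>Q. piece Z \<and> card (T \<inter> Z) < card T)"
proof -
  have TX: "T \<subseteq> X" "T \<union> Y \<subseteq> X"
    using T(1) Y(2) by blast+
  obtain W A B where W: "W \<in> F" "T \<union> Y \<subseteq> W" "W \<subseteq> X" and AB: "A \<in> F" "B \<in> F" "W = A \<union> B" "A \<inter> B = {}"
    "\<not> T \<union> Y \<subseteq> A" "\<not> T \<union> Y \<subseteq> B"
    by (rule minimal_member[OF X TX(1) T(2) Un_upper1 TX(2)])
  \<comment> \<open>If \<open>Y\<close> lay in neither child, both children would lie in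
    \<open>Y\<close>, and so would \<open>T\<close>.\<close>
  have "Y \<subseteq> A \<or> Y \<subseteq> B"
  proof (rule ccontr)
    assume no: "\<not> ?thesis"
    then have "A \<subseteq> Y \<or> A \<inter> Y = {}" "B \<subseteq> Y \<or> B \<inter> Y = {}"
      using nested_or_disjoint[OF AB(1) Y(1)] nested_or_disjoint[OF AB(2) Y(1)] by blast+
    moreover have "Y \<subseteq> A \<union> B" "Y \<noteq> {}"
      using W(2) AB(3) mem_nonempty[OF Y(1)] by blast+
    ultimately have "A \<union> B \<subseteq> Y"
      using no by blast
    then have "T \<subseteq> Y"
      using W(2) AB(3) by blast
    then have "T = {}"
      using T(1) by blast
    then show False
      using T(2) by simp
  qed
  then obtain C D where CD: "C \<in> F" "D \<in> F" "W = C \<union> D" "C \<inter> D = {}" "Y \<subseteq> C" "\<not> T \<subseteq> C"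
    using AB by (metis Int_commute Un_commute Un_least)
  have TD: "\<exists>Q. partition_on D Q \<and> card Q \<le> 3 \<and> finite Q \<and> (\<forall>Z\<in>Q. piece Z \<and> card (T \<inter> Z) < card T)"
  proof (cases "T \<subseteq> D")
    case True
    obtain Q where Q: "partition_on D Q" "card Q \<le> 3" "\<forall>Z\<in>Q. piece Z \<and> card (T \<inter> Z) < card T"
      using split_member[OF CD(2) True T(2)] by blast
    then show ?thesis
      using finite_elements[OF finite_mem[OF CD(2)]] by blast
  next
    case False
    then show ?thesis
      using partition_on_space[OF mem_nonempty[OF CD(2)]] piece_mem[OF CD(2)] card_Int_less[OF T(2)]
      by (intro exI[of _ "{D}"]) simp
  qed
  then obtain Q where Q: "partition_on D Q" "card Q \<le> 3" "finite Q" "\<forall>Z\<in>Q. piece Z \<and> card (T \<inter> Z) < card T"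
    by blast
  let ?R = "({X - W} - {{}}) \<union> (({C - Y} - {{}}) \<union> Q)"
  have "partition_on ((X - W) \<union> ((C - Y) \<union> D)) ?R"
    using CD(3,4) by (intro partition_on_Un partition_on_trivial Q(1)) auto
  moreover have "(X - W) \<union> ((C - Y) \<union> D) = X - Y"
    using CD(3-5) W(3) by blast
  moreover have "card ?R \<le> 5"
  proof -
    have "card ?R \<le> card ({X - W, C - Y} \<union> Q)"
      using Q(3) by (intro card_mono) auto
    also have "\<dots> \<le> card {X - W, C - Y} + card Q"
      by (rule card_Un_le)
    also have "\<dots> \<le> 2 + 3"
      using Q(2) by (intro add_mono) (simp_all add: card_insert_if)
    finally show ?thesis
      by simp
  qed
  moreover have "piece Z \<and> card (T \<inter> Z) < card T" if "Z \<in> ?R" for Z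
  proof -
    consider "Z = X - W" "X - W \<noteq> {}" | "Z = C - Y" "C - Y \<noteq> {}" | "Z \<in> Q"
      using \<open>Z \<in> ?R\<close> by blast
    then show ?thesis
    proof cases
      case 1
      then have "T \<inter> Z = {}"
        using W(2) by blast
      then have "card (T \<inter> Z) < card T"
        using T(2) by simp
      then show ?thesis
        using piece_diff[OF X W(1,3) 1(2)] 1(1) by simp
    next
      case 2
      have "\<not> T \<subseteq> C - Y"
        using CD(6) by blast
      then show ?thesis
        using piece_diff[OF CD(1) Y(1) CD(5) 2(2)] card_Int_less[OF T(2), of Z] 2(1) by simp
    next
      case 3
      then show ?thesis
        using Q(4) by blast
    qed
  qed
  ultimately show ?thesis
    by (intro exI[of _ ?R]) auto
qed

lemma split_piece:
  assumes "piece Z" "T \<subseteq> Z" "2 \<le> card T"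
  shows "\<exists>Q. partition_on Z Q \<and> card Q \<le> 5 \<and> (\<forall>A\<in>Q. piece A \<and> card (T \<inter> A) < card T)"
proof -
  obtain X Y where X: "X \<in> F" and Y: "Y \<in> insert {} F" "Y \<subseteq> X" and Z: "Z = X - Y"
    using assms(1) unfolding piece_def by blast
  show ?thesis
  proof (cases "Y = {}")
    case True
    then have "Z = X"
      using Z by simp
    then obtain Q where "partition_on Z Q" "card Q \<le> 3" "\<forall>A\<in>Q. piece A \<and> card (T \<inter> A) < card T"
      using split_member[OF X _ assms(3)] assms(2) by blast
    then show ?thesis
      by (intro exI[of _ Q]) simp
  next
    case False
    then show ?thesis
      using split_difference[OF X _ Y(2) _ assms(3)] Y(1) assms(2) unfolding Z by blast
  qed
qed

text \<open>Each split lowers the number of vertices of \<open>T\<close> in a part by at least one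
  and multiplies the number of parts by at most \<open>5\<close>.\<close>

lemma shatter_piece:
  assumes "piece Z" "T \<subseteq> Z" "card T \<le> n"
  shows "\<exists>Q. partition_on Z Q \<and> card Q \<le> 5 ^ n \<and> (\<forall>A\<in>Q. piece A \<and> card (T \<inter> A) \<le> 1)"
  using assms
proof (induction n arbitrary: Z T)
  case 0
  have "card (T \<inter> Z) \<le> 1"
    using 0(2,3) by (simp add: Int_absorb2)
  then show ?case
    using partition_on_space[of Z] 0(1) by (intro exI[of _ "{Z}"]) (auto simp: piece_def)
next
  case (Suc n)
  show ?case
  proof (cases "card T \<le> 1")
    case True
    then have "card (T \<inter> Z) \<le> 1"
      using Suc.prems(2) by (simp add: Int_absorb2)
    then show ?thesis
      using partition_on_space[of Z] Suc.prems(1) by (intro exI[of _ "{Z}"]) (auto simp: piece_def)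
  next
    case False
    then have T: "2 \<le> card T"
      by simp
    obtain P where P: "partition_on Z P" "card P \<le> 5" "\<forall>A\<in>P. piece A \<and> card (T \<inter> A) < card T"
      using split_piece[OF Suc.prems(1,2) T] by blast
    have "\<forall>A\<in>P. \<exists>Q. partition_on A Q \<and> card Q \<le> 5 ^ n \<and> (\<forall>B\<in>Q. piece B \<and> card (T \<inter> A \<inter> B) \<le> 1)"
    proof
      fix A assume "A \<in> P"
      then have "piece A" "card (T \<inter> A) \<le> n"
        using P(3) Suc.prems(3) by fastforce+
      then show "\<exists>Q. partition_on A Q \<and> card Q \<le> 5 ^ n \<and> (\<forall>B\<in>Q. piece B \<and> card (T \<inter> A \<inter> B) \<le> 1)"
        by (intro Suc.IH) auto
    qed
    from bchoice[OF this] obtain f where f: "\<forall>A\<in>P. partition_on A (f A) \<and> card (f A) \<le> 5 ^ n \<and>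
        (\<forall>B\<in>f A. piece B \<and> card (T \<inter> A \<inter> B) \<le> 1)"
      by (elim exE)
    have finP: "finite P"
      using finite_elements[OF finite_subset[OF piece_subset[OF Suc.prems(1)] finite_verts] P(1)] .
    let ?Q = "\<Union>A\<in>P. f A"
    have "partition_on Z ?Q"
      using f by (intro partition_on_UN[OF P(1)]) blast
    moreover have "card ?Q \<le> 5 ^ Suc n"
    proof -
      have "card ?Q \<le> (\<Sum>A\<in>P. card (f A))"
        using finP by (rule card_UN_le)
      also have "\<dots> \<le> (\<Sum>A\<in>P. 5 ^ n)"
        using f by (intro sum_mono) blast
      also have "\<dots> = card P * 5 ^ n"
        by simp
      also have "\<dots> \<le> 5 * 5 ^ n"
        using P(2) by (rule mult_le_mono1)
      finally show ?thesis
        by simp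
    qed
    moreover have "piece B \<and> card (T \<inter> B) \<le> 1" if B: "B \<in> ?Q" for B
    proof -
      obtain A where A: "A \<in> P" "B \<in> f A"
        using B by blast
      have "B \<subseteq> A"
        using f A partition_onD1[of A "f A"] by blast
      then have "T \<inter> A \<inter> B = T \<inter> B"
        by blast
      then show ?thesis
        using f A by metis
    qed
    ultimately show ?thesis
      by (intro exI[of _ ?Q]) simp
  qed
qed

end

subsection \<open>Vertex orders with few atomic types in every ball\<close>

text \<open>Outside \<open>S\<close> the type of a vertex of \<open>Z\<close> is composed of its
  external neighbourhood and its trace on \<open>S \<inter> Z\<close>, giving
  \<open>p * 2 ^ c\<close>; the summand \<open>c\<close> accounts for the singletons in
  \<open>S\<close>.\<close>

lemma card_atomic_types_le:
  assumes "finite Z" "card (out_nbhds G Z) \<le> p" "card (S \<inter> Z) \<le> c"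
  shows "card (atomic_type G S ` Z) \<le> c + p * 2 ^ c"
proof -
  let ?A = "(Inl :: 'a \<Rightarrow> 'a + 'a set) ` (S \<inter> Z)"
  let ?g = "\<lambda>(N, M). Inr ((N \<inter> S) \<union> M) :: 'a + 'a set"
  let ?B = "?g ` (out_nbhds G Z \<times> Pow (S \<inter> Z))"
  have fin: "finite (S \<inter> Z)" "finite (out_nbhds G Z)"
    using assms(1) unfolding out_nbhds_def by simp_all
  have fin_prod: "finite (out_nbhds G Z \<times> Pow (S \<inter> Z))"
    by (intro finite_cartesian_product fin(2) finite_Pow_iff[THEN iffD2] fin(1))
  have "atomic_type G S ` Z \<subseteq> ?A \<union> ?B"
  proof
    fix a assume "a \<in> atomic_type G S ` Z"
    then obtain z where z: "z \<in> Z" "a = atomic_type G S z"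
      by blast
    show "a \<in> ?A \<union> ?B"
    proof (cases "z \<in> S")
      case True
      then show ?thesis
        using z unfolding atomic_type_def by simp
    next
      case False
      have "a = ?g (nbhd G z - Z, nbhd G z \<inter> (S \<inter> Z))"
        using False z(2) unfolding atomic_type_def by auto
      moreover have "(nbhd G z - Z, nbhd G z \<inter> (S \<inter> Z)) \<in> out_nbhds G Z \<times> Pow (S \<inter> Z)"
        using z(1) unfolding out_nbhds_def by blast
      ultimately show ?thesis
        by (metis (no_types, lifting) UnI2 imageI)
    qed
  qed
  then have "card (atomic_type G S ` Z) \<le> card (?A \<union> ?B)"
    using fin(1) fin_prod by (intro card_mono finite_UnI finite_imageI)
  also have "\<dots> \<le> card ?A + card ?B"
    by (rule card_Un_le)
  also have "\<dots> \<le> c + p * 2 ^ c"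
  proof (rule add_mono)
    show "card ?A \<le> c"
      using card_image_le[OF fin(1), of "Inl :: 'a \<Rightarrow> 'a + 'a set"] assms(3) by linarith
    have "card ?B \<le> card (out_nbhds G Z \<times> Pow (S \<inter> Z))"
      using fin_prod by (rule card_image_le)
    also have "\<dots> = card (out_nbhds G Z) * 2 ^ card (S \<inter> Z)"
      by (simp only: card_cartesian_product card_Pow[OF fin(1)])
    also have "\<dots> \<le> p * 2 ^ c"
      using assms(2,3) by (intro mult_le_mono) simp_all
    finally show "card ?B \<le> p * 2 ^ c" .
  qed
  finally show ?thesis .
qed

definition step_size :: "nat \<Rightarrow> nat" where
  "step_size k = 1 + 5 ^ (resolver_size k + 2) * resolver_size k"

definition type_bound :: "nat \<Rightarrow> nat" where
  "type_bound k = (let c = Suc (resolver_size k) + step_size k in c + piece_types k * 2 ^ c)"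

context cut_decomposition
begin

definition resolved_partition :: "nat \<Rightarrow> 'a set set \<Rightarrow> 'a set \<Rightarrow> bool" where
  "resolved_partition c Q S \<longleftrightarrow> S \<subseteq> verts G \<and> partition_on (verts G) Q \<and>
     (\<forall>Z\<in>Q. piece Z \<and> resolves G S Z \<and> card (S \<inter> Z) \<le> c)"

text \<open>\<open>swap\<close> is the exchange of one end through a representative of the other.
  Two swaps suffice unless \<open>Zx' = Zy\<close> and \<open>Zy' = Zx\<close>, where either first
  swap would put both ends into one piece.\<close>

lemma resolved_partition_homogeneous:
  assumes cfg: "resolved_partition c Q S"
    and x: "Zx \<in> Q" "x \<in> Zx" "Zx' \<in> Q" "x' \<in> Zx'" "atomic_type G S x = atomic_type G S x'"
    and y: "Zy \<in> Q" "y \<in> Zy" "Zy' \<in> Q" "y' \<in> Zy'" "atomic_type G S y = atomic_type G S y'"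
    and ne: "Zx \<noteq> Zy" "Zx' \<noteq> Zy'" and e: "x \<in> nbhd G y"
  shows "x' \<in> nbhd G y'"
proof -
  have part: "partition_on (verts G) Q" and res: "\<And>Z. Z \<in> Q \<Longrightarrow> resolves G S Z"
    using cfg unfolding resolved_partition_def by blast+
  have notin: "z \<notin> Z'" if "Z \<in> Q" "z \<in> Z" "Z' \<in> Q" "Z \<noteq> Z'" for z Z Z'
    using partition_on_disjointD[OF part that(1,3) that(2)] that(4) by blast
  have swap: "u' \<in> nbhd G v"
    if u: "u \<in> nbhd G v" "atomic_type G S u = atomic_type G S u'" and Z: "Z \<in> Q" "v \<in> Z" "u \<notin> Z" "u' \<notin> Z"
    for u u' v Z
  proof -
    obtain s where s: "s \<in> S \<inter> Z" "nbhd G s - Z = nbhd G v - Z"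
      by (rule resolves_representative[OF res[OF Z(1)] Z(2)])
    have "u \<in> nbhd G s"
      using u(1) Z(3) s(2) by blast
    then have "s \<in> nbhd G u"
      using nbhd_sym by metis
    then have "s \<in> nbhd G u'"
      using u(2) s(1) unfolding atomic_type_eq_iff by blast
    then have "u' \<in> nbhd G s"
      using nbhd_sym by metis
    then show ?thesis
      using Z(4) s(2) by blast
  qed
  consider "Zx' \<noteq> Zy" | "Zy' \<noteq> Zx" | "Zx' = Zy" "Zy' = Zx"
    by blast
  then show ?thesis
  proof cases
    case 1
    have "x' \<in> nbhd G y"
      using swap[OF e x(5) y(1,2)] notin[OF x(1,2) y(1) ne(1)] notin[OF x(3,4) y(1) 1] by blast
    then have "y \<in> nbhd G x'"
      using nbhd_sym by metis
    then have "y' \<in> nbhd G x'"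
      using swap[OF _ y(5) x(3,4)] notin[OF y(1,2) x(3)] notin[OF y(3,4) x(3)] ne(2) 1 by blast
    then show ?thesis
      using nbhd_sym by metis
  next
    case 2
    have "y \<in> nbhd G x"
      using e nbhd_sym by metis
    then have "y' \<in> nbhd G x"
      using swap[OF _ y(5) x(1,2)] notin[OF y(1,2) x(1)] notin[OF y(3,4) x(1)] ne(1) 2 by blast
    then have "x \<in> nbhd G y'"
      using nbhd_sym by metis
    then show ?thesis
      using swap[OF _ x(5) y(3,4)] notin[OF x(1,2) y(3)] notin[OF x(3,4) y(3)] ne(2) 2 by blast
  next
    case 3
    let ?Z = "Zy"
    have in_Z: "y \<in> ?Z" "x' \<in> ?Z"
      using y(2) x(4) 3 by auto
    have out_Z: "x \<notin> ?Z" "y' \<notin> ?Z"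
      using notin[OF x(1,2) y(1) ne(1)] notin[OF y(3,4) y(1)] 3 ne(1) by auto
    have nS: "x' \<notin> S" "y \<notin> S" "nbhd G x \<inter> S = nbhd G x' \<inter> S" "nbhd G y \<inter> S = nbhd G y' \<inter> S"
      using x(5) y(5) in_Z out_Z unfolding atomic_type_eq_iff by auto
    show ?thesis
    proof (rule ccontr)
      assume no: "x' \<notin> nbhd G y'"
      \<comment> \<open>\<open>resolves\<close> is contradicted at \<open>x'\<close> and
        \<open>y\<close>: representatives of \<open>y\<close> in \<open>?Z\<close> see
        \<open>x\<close>, hence \<open>x'\<close>; those of \<open>x'\<close> miss
        \<open>y'\<close>, hence \<open>y\<close>.\<close>
      have a: "\<forall>s\<in>S \<inter> ?Z. nbhd G s - ?Z = nbhd G y - ?Z \<longrightarrow> s \<in> nbhd G x'"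
      proof (intro ballI impI)
        fix s assume s: "s \<in> S \<inter> ?Z" "nbhd G s - ?Z = nbhd G y - ?Z"
        then have "x \<in> nbhd G s"
          using e out_Z(1) by blast
        then have "s \<in> nbhd G x"
          using nbhd_sym by metis
        then show "s \<in> nbhd G x'"
          using nS(3) s(1) by blast
      qed
      have b: "\<forall>s\<in>S \<inter> ?Z. nbhd G s - ?Z = nbhd G x' - ?Z \<longrightarrow> s \<notin> nbhd G y"
      proof (intro ballI impI notI)
        fix s assume s: "s \<in> S \<inter> ?Z" "nbhd G s - ?Z = nbhd G x' - ?Z" "s \<in> nbhd G y"
        then have "s \<in> nbhd G y'"
          using nS(4) by blast
        then have "y' \<in> nbhd G s"
          using nbhd_sym by metis
        then have "y' \<in> nbhd G x'"
          using s(2) out_Z(2) by blast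
        then show False
          using no nbhd_sym by metis
      qed
      have "x' \<in> ?Z - S" "y \<in> ?Z - S"
        using in_Z nS(1,2) by auto
      from res[OF y(1), unfolded resolves_def, THEN bspec, OF this(1), THEN bspec, OF this(2)]
      show False
        using a b by blast
    qed
  qed
qed

text \<open>A type may spread over many pieces, so the flip is chosen with the pieces as colours;
  the ball then stays inside one piece.\<close>

lemma resolved_partition_types_le:
  assumes cfg: "resolved_partition c Q S" and v: "v \<in> verts G"
  shows "card (parts_meeting (flip_ball G (atomic_type_partition G S) \<infinity> v) (atomic_type_partition G S))
    \<le> c + piece_types k * 2 ^ c"
proof -
  let ?P = "fibres (verts G) (atomic_type G S)"
  have S: "S \<subseteq> verts G" and part: "partition_on (verts G) Q"
    and Q: "\<And>Z. Z \<in> Q \<Longrightarrow> piece Z \<and> card (S \<inter> Z) \<le> c"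
    using cfg unfolding resolved_partition_def by blast+
  have "\<forall>x\<in>verts G. \<exists>Z. Z \<in> Q \<and> x \<in> Z"
    using partition_onD1[OF part] by blast
  from bchoice[OF this] obtain p where p0: "\<forall>x\<in>verts G. p x \<in> Q \<and> x \<in> p x"
    by (elim exE)
  note p = p0[THEN bspec, THEN conjunct1] p0[THEN bspec, THEN conjunct2]
  obtain H where H: "H \<in> flips G ?P" "\<And>x y. {x, y} \<in> edges H \<Longrightarrow> p x = p y"
  proof (rule flip_separating_colours[OF simple, of "atomic_type G S" p])
    fix x x' y y'
    assume V: "x \<in> verts G" "x' \<in> verts G" "y \<in> verts G" "y' \<in> verts G"
      and eq: "atomic_type G S x = atomic_type G S x'" "atomic_type G S y = atomic_type G S y'"
      and ne: "p x \<noteq> p y" "p x' \<noteq> p y'" and e: "{x, y} \<in> edges G"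
    show "{x', y'} \<in> edges G"
      using resolved_partition_homogeneous[OF cfg p[OF V(1)] p[OF V(2)] eq(1) p[OF V(3)] p[OF V(4)] eq(2) ne] e
      unfolding nbhd_iff by blast
  qed (rule that)
  have finP: "finite ?P"
    by (rule finite_elements[OF finite_verts partition_on_fibres])
  have HV: "verts H = verts G"
    using H(1) unfolding flips_def flip_by_def by auto
  have "flip_ball G ?P \<infinity> v \<subseteq> {u \<in> verts G. p u = p v}"
    using flip_ball_subset_graph_ball[OF H(1) finP] graph_ball_monochromatic[of H p v, OF H(2)] HV by blast
  also have "\<dots> \<subseteq> p v"
  proof
    fix u assume "u \<in> {u \<in> verts G. p u = p v}"
    then show "u \<in> p v"
      using p(2)[of u] by simp
  qed
  finally have "card (parts_meeting (flip_ball G ?P \<infinity> v) ?P) \<le> card (parts_meeting (p v) ?P)"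
    by (rule card_parts_meeting_mono[OF _ finP])
  also have "\<dots> = card (atomic_type G S ` p v)"
    using piece_subset Q p(1)[OF v] finite_verts by (intro card_parts_meeting_fibres) auto
  also have "\<dots> \<le> c + piece_types k * 2 ^ c"
    using Q[OF p(1)[OF v]] finite_subset[OF piece_subset finite_verts]
    by (intro card_atomic_types_le card_out_nbhds_piece) auto
  finally show ?thesis
    unfolding atomic_type_partition_eq_fibres[OF S] .
qed

text \<open>Lets a partition last while further vertices join the prefix: resolving survives
  enlargement of \<open>S\<close>, only the count per piece grows.\<close>

lemma resolved_partition_extend:
  assumes cfg: "resolved_partition c Q S" and "S \<subseteq> S'" "S' \<subseteq> verts G" "card (S' - S) \<le> d"
  shows "resolved_partition (c + d) Q S'"
proof -
  have "card (S' \<inter> Z) \<le> c + d" if "Z \<in> Q" for Z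
  proof -
    have "S' \<inter> Z \<subseteq> (S \<inter> Z) \<union> (S' - S)"
      by blast
    moreover have "finite S'" "finite S"
      using finite_subset[OF assms(3) finite_verts] finite_subset[OF assms(2)] by blast+
    ultimately have "card (S' \<inter> Z) \<le> card ((S \<inter> Z) \<union> (S' - S))"
      by (intro card_mono) auto
    also have "\<dots> \<le> card (S \<inter> Z) + card (S' - S)"
      by (rule card_Un_le)
    also have "\<dots> \<le> c + d"
      using cfg that assms(4) unfolding resolved_partition_def by (intro add_mono) auto
    finally show ?thesis .
  qed
  then show ?thesis
    using cfg assms(3) resolves_mono[OF _ assms(2)] unfolding resolved_partition_def by blast
qed

text \<open>Only the piece \<open>Z\<close> of a new vertex \<open>x\<close> is rebuilt. It is
  shattered so that each part holds at most one vertex of \<open>insert x (S \<inter> Z)\<close>,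
  and each part then gets a resolver inside itself; this restores the bound
  \<open>Suc (resolver_size k)\<close>.\<close>

lemma resolved_partition_step:
  assumes cfg: "resolved_partition (Suc (resolver_size k)) Q S" and "S \<noteq> verts G"
  obtains Q' S' where "resolved_partition (Suc (resolver_size k)) Q' S'" "S \<subset> S'" "card (S' - S) \<le> step_size k"
proof -
  let ?r = "resolver_size k"
  have S: "S \<subseteq> verts G" and part: "partition_on (verts G) Q"
    and Q: "\<And>Z. Z \<in> Q \<Longrightarrow> piece Z \<and> resolves G S Z \<and> card (S \<inter> Z) \<le> Suc ?r"
    using cfg unfolding resolved_partition_def by blast+
  obtain x where x: "x \<in> verts G" "x \<notin> S"
    using S assms(2) by blast
  then obtain Z where Z: "Z \<in> Q" "x \<in> Z"
    using partition_onD1[OF part] by blast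
  let ?T = "insert x (S \<inter> Z)"
  have ZV: "Z \<subseteq> verts G" "piece Z"
    using Q[OF Z(1)] piece_subset by blast+
  \<comment> \<open>At most \<open>Suc ?r\<close> old vertices, and \<open>x\<close>: the exponent
    in \<open>step_size\<close>.\<close>
  have "card ?T \<le> ?r + 2"
    using Q[OF Z(1)] finite_subset[OF S finite_verts] x(2) by simp
  moreover have "?T \<subseteq> Z"
    using Z(2) by blast
  ultimately obtain R where R: "partition_on Z R" "card R \<le> 5 ^ (?r + 2)"
    "\<forall>A\<in>R. piece A \<and> card (?T \<inter> A) \<le> 1"
    using shatter_piece[OF ZV(2)] by blast
  have finR: "finite R"
    using finite_elements[OF finite_subset[OF ZV(1) finite_verts] R(1)] .
  have "\<forall>A\<in>R. \<exists>B. B \<subseteq> A \<and> card B \<le> ?r \<and> resolves G B A"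
  proof
    fix A assume "A \<in> R"
    then have A: "piece A"
      using R(3) by blast
    obtain B where "B \<subseteq> A" "card B \<le> ?r" "resolves G B A"
      by (rule resolver_exists[OF piece_subset[OF A] card_out_nbhds_piece[OF A]])
    then show "\<exists>B. B \<subseteq> A \<and> card B \<le> ?r \<and> resolves G B A"
      by blast
  qed
  from bchoice[OF this] obtain \<sigma> where \<sigma>: "\<forall>A\<in>R. \<sigma> A \<subseteq> A \<and> card (\<sigma> A) \<le> ?r \<and> resolves G (\<sigma> A) A"
    by (elim exE)
  define N where "N = (\<Union>A\<in>R. \<sigma> A)"
  have RZ: "A \<subseteq> Z" if "A \<in> R" for A
    using partition_onD1[OF R(1)] that by blast
  have NZ: "N \<subseteq> Z"
    using \<sigma> RZ unfolding N_def by blast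
  have finN: "finite N"
    using finite_subset[OF NZ finite_subset[OF ZV(1) finite_verts]] .
  have cardN: "card N \<le> 5 ^ (?r + 2) * ?r"
  proof -
    have "card N \<le> (\<Sum>A\<in>R. card (\<sigma> A))"
      unfolding N_def using finR by (rule card_UN_le)
    also have "\<dots> \<le> (\<Sum>A\<in>R. ?r)"
      using \<sigma> by (intro sum_mono) blast
    also have "\<dots> = card R * ?r"
      by simp
    also have "\<dots> \<le> 5 ^ (?r + 2) * ?r"
      using R(2) by (rule mult_le_mono1)
    finally show ?thesis .
  qed
  let ?S = "insert x (S \<union> N)" and ?Q = "(Q - {Z}) \<union> R"
  show ?thesis
  proof (rule that)
    show "S \<subset> ?S"
      using x(2) by blast
    have "card (?S - S) \<le> card (insert x N)"
      using finN by (intro card_mono) auto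
    also have "\<dots> \<le> Suc (card N)"
      using finN by (simp add: card_insert_if)
    also have "\<dots> \<le> step_size k"
      using cardN unfolding step_size_def by simp
    finally show "card (?S - S) \<le> step_size k" .
    show "resolved_partition (Suc ?r) ?Q ?S"
      unfolding resolved_partition_def
    proof (intro conjI ballI)
      show "?S \<subseteq> verts G"
        using S x(1) NZ ZV(1) by blast
      have "partition_on ((verts G - Z) \<union> Z) ?Q"
        by (intro partition_on_Un partition_on_remove[OF part Z(1)] R(1)) blast
      moreover have "(verts G - Z) \<union> Z = verts G"
        using ZV(1) by blast
      ultimately show "partition_on (verts G) ?Q"
        by simp
      fix A assume "A \<in> ?Q"
      then consider "A \<in> Q" "A \<noteq> Z" | "A \<in> R"
        by blast
      then have "piece A \<and> resolves G ?S A \<and> card (?S \<inter> A) \<le> Suc ?r"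
      proof cases
        case 1
        have "A \<inter> Z = {}"
          using partition_on_disjointD[OF part 1(1) Z(1)] 1(2) by blast
        then have "?S \<inter> A = S \<inter> A"
          using NZ Z(2) by blast
        moreover have "resolves G ?S A"
          by (rule resolves_mono[OF Q[OF 1(1), THEN conjunct2, THEN conjunct1]]) blast
        ultimately show ?thesis
          using Q[OF 1(1)] by simp
      next
        case 2
        have \<sigma>A: "\<sigma> A \<subseteq> A" "card (\<sigma> A) \<le> ?r" "resolves G (\<sigma> A) A"
          using \<sigma> 2 by blast+
        have "N \<inter> A \<subseteq> \<sigma> A"
        proof
          fix z assume z: "z \<in> N \<inter> A"
          then obtain B where B: "B \<in> R" "z \<in> \<sigma> B"
            unfolding N_def by blast
          then have "z \<in> B"
            using \<sigma> by blast
          then have "B = A"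
            using partition_on_disjointD[OF R(1) B(1) 2] z by blast
          then show "z \<in> \<sigma> A"
            using B(2) by simp
        qed
        then have "?S \<inter> A \<subseteq> (?T \<inter> A) \<union> \<sigma> A"
          using RZ[OF 2] by blast
        moreover have "finite ((?T \<inter> A) \<union> \<sigma> A)"
          using finite_subset[OF \<sigma>A(1)] finite_subset[OF RZ[OF 2]] finite_subset[OF ZV(1) finite_verts] by auto
        ultimately have "card (?S \<inter> A) \<le> card ((?T \<inter> A) \<union> \<sigma> A)"
          by (intro card_mono)
        also have "\<dots> \<le> card (?T \<inter> A) + card (\<sigma> A)"
          by (rule card_Un_le)
        also have "\<dots> \<le> 1 + ?r"
          using R(3) 2 \<sigma>A(2) by (intro add_mono) auto
        finally have "card (?S \<inter> A) \<le> Suc ?r"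
          by simp
        moreover have "\<sigma> A \<subseteq> ?S"
          using 2 unfolding N_def by blast
        then have "resolves G ?S A"
          by (rule resolves_mono[OF \<sigma>A(3)])
        ultimately show ?thesis
          using R(3) 2 by blast
      qed
      then show "piece A" "resolves G ?S A" "card (?S \<inter> A) \<le> Suc ?r"
        by simp_all
    qed
  qed
qed

text \<open>Vertices arrive in batches of size at most \<open>step_size k\<close>, in arbitrary
  order inside a batch. Prefixes ending inside a batch are served by the partition from its start,
  at the price of the summand \<open>step_size k\<close>.\<close>

lemma resolved_order_exists:
  assumes "resolved_partition (Suc (resolver_size k)) Q S"
  shows "\<exists>vs. distinct vs \<and> set vs = verts G - S \<and> (\<forall>n\<le>length vs.
    \<exists>Q. resolved_partition (Suc (resolver_size k) + step_size k) Q (S \<union> set (take n vs)))"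
  using assms
proof (induction "card (verts G - S)" arbitrary: Q S rule: less_induct)
  case less
  let ?c = "Suc (resolver_size k)"
  have SV: "S \<subseteq> verts G"
    using less.prems unfolding resolved_partition_def by blast
  show ?case
  proof (cases "S = verts G")
    case True
    have "resolved_partition (?c + step_size k) Q S"
      using resolved_partition_extend[OF less.prems order_refl SV] by simp
    then show ?thesis
      using True by (intro exI[of _ "[]"]) auto
  next
    case False
    obtain Q' S' where Q': "resolved_partition ?c Q' S'" "S \<subset> S'" "card (S' - S) \<le> step_size k"
      by (rule resolved_partition_step[OF less.prems False])
    have S'V: "S' \<subseteq> verts G"
      using Q'(1) unfolding resolved_partition_def by blast
    have "card (verts G - S') < card (verts G - S)"
      using finite_verts Q'(2) S'V by (intro psubset_card_mono) auto
    from less.hyps[OF this Q'(1)] obtain vs where vs: "distinct vs" "set vs = verts G - S'"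
      "\<forall>n\<le>length vs. \<exists>Q. resolved_partition (?c + step_size k) Q (S' \<union> set (take n vs))"
      by (elim exE conjE)
    obtain ws where ws: "set ws = S' - S" "distinct ws"
      using finite_distinct_list[of "S' - S"] finite_subset[OF S'V finite_verts] by auto
    have "\<exists>Q. resolved_partition (?c + step_size k) Q (S \<union> set (take n (ws @ vs)))"
      if n: "n \<le> length (ws @ vs)" for n
    proof (cases "n \<le> length ws")
      case True
      have sub: "set (take n ws) \<subseteq> S' - S"
        using set_take_subset[of n ws] ws(1) by blast
      have "card (S \<union> set (take n ws) - S) \<le> card (S' - S)"
        using sub finite_subset[OF S'V finite_verts] by (intro card_mono) auto
      then have "card (S \<union> set (take n ws) - S) \<le> step_size k"
        using Q'(3) by linarith
      moreover have "S \<union> set (take n ws) \<subseteq> verts G"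
        using sub SV S'V by blast
      ultimately have "resolved_partition (?c + step_size k) Q (S \<union> set (take n ws))"
        by (intro resolved_partition_extend[OF less.prems]) auto
      then show ?thesis
        using True by auto
    next
      case False
      have "S \<union> set (take n (ws @ vs)) = S' \<union> set (take (n - length ws) vs)"
        using False ws(1) Q'(2) by auto
      moreover have "n - length ws \<le> length vs"
        using n by simp
      ultimately show ?thesis
        using vs(3) by metis
    qed
    moreover have "distinct (ws @ vs)"
      using vs(1,2) ws by auto
    moreover have "set (ws @ vs) = verts G - S"
      using vs(2) ws(1) Q'(2) S'V by auto
    ultimately show ?thesis
      by blast
  qed
qed

lemma dmw_le: "dmw \<infinity> G \<le> enat (type_bound k)"
proof -
  let ?c = "Suc (resolver_size k)" and ?P = "atomic_type_partition G"
  let ?d = "?c + step_size k"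
  obtain S where S: "S \<subseteq> verts G" "card S \<le> resolver_size k" "resolves G S (verts G)"
    by (rule resolver_exists[OF order_refl card_out_nbhds_piece[OF piece_mem[OF verts_mem]]])
  have "resolved_partition ?c {verts G} S"
    unfolding resolved_partition_def
    using S partition_on_space[OF verts_nonempty] piece_mem[OF verts_mem] by (simp add: Int_absorb2)
  from resolved_order_exists[OF this] obtain vs where vs: "distinct vs" "set vs = verts G - S"
    "\<forall>n\<le>length vs. \<exists>Q. resolved_partition ?d Q (S \<union> set (take n vs))"
    by (elim exE conjE)
  obtain ws where ws: "set ws = S" "distinct ws"
    using finite_distinct_list[OF finite_subset[OF S(1) finite_verts]] by blast
  let ?vs = "ws @ vs"
  have bound: "card (parts_meeting (flip_ball G (?P (set (take n ?vs))) \<infinity> v) (?P (set (take n ?vs)))) \<le> type_bound k"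
    if n: "n \<le> length ?vs" and v: "v \<in> verts G" for n v
  proof (cases "n \<le> length ws")
    \<comment> \<open>A proper prefix of the initial resolver may fail to resolve
      \<open>verts G\<close>, but it is so short that there are boundedly many types on all of
      \<open>verts G\<close>.\<close>
    case True
    let ?S = "set (take n ?vs)"
    have sub: "?S \<subseteq> S"
      using True set_take_subset[of n ws] ws(1) by simp
    then have SV: "?S \<subseteq> verts G"
      using S(1) by blast
    have fin: "finite (?P ?S)"
      unfolding atomic_type_partition_eq_fibres[OF SV]
      by (rule finite_elements[OF finite_verts partition_on_fibres])
    have "card (?S \<inter> verts G) \<le> card S"
      using sub S(1) finite_subset[OF S(1) finite_verts] by (intro card_mono) auto
    then have card: "card (?S \<inter> verts G) \<le> ?d"
      using S(2) by linarith
    have "flip_ball G (?P ?S) \<infinity> v \<subseteq> verts G"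
      unfolding flip_ball_def ball_of_infinity by blast
    then have "card (parts_meeting (flip_ball G (?P ?S) \<infinity> v) (?P ?S)) \<le> card (parts_meeting (verts G) (?P ?S))"
      by (rule card_parts_meeting_mono[OF _ fin])
    also have "\<dots> = card (atomic_type G ?S ` verts G)"
      unfolding atomic_type_partition_eq_fibres[OF SV] by (rule card_parts_meeting_fibres[OF order_refl finite_verts])
    also have "\<dots> \<le> type_bound k"
      using card_atomic_types_le[OF finite_verts card_out_nbhds_piece[OF piece_mem[OF verts_mem]] card]
      unfolding type_bound_def Let_def .
    finally show ?thesis .
  next
    case False
    have eq: "set (take n ?vs) = S \<union> set (take (n - length ws) vs)"
      using False ws(1) by auto
    have "n - length ws \<le> length vs"
      using n by simp
    then obtain Q where "resolved_partition ?d Q (S \<union> set (take (n - length ws) vs))"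
      using vs(3) by blast
    from resolved_partition_types_le[OF this v] show ?thesis
      unfolding eq type_bound_def Let_def .
  qed
  show ?thesis
    unfolding dmw_def
  proof (rule Inf_lower2)
    show "(SUP i\<in>{1..length ?vs}. SUP v\<in>verts G.
            (let P = ?P (set (take (length ?vs - i) ?vs))
             in enat (card (parts_meeting (flip_ball G P \<infinity> v) P)))) \<le> enat (type_bound k)"
      unfolding Let_def
      by (intro SUP_least enat_ord_simps(1)[THEN iffD2] bound diff_le_self)
    have "distinct ?vs" "set ?vs = verts G"
      using vs(1,2) ws S(1) by auto
    then show "(SUP i\<in>{1..length ?vs}. SUP v\<in>verts G.
            (let P = ?P (set (take (length ?vs - i) ?vs))
             in enat (card (parts_meeting (flip_ball G P \<infinity> v) P)))) \<in>
        {SUP i\<in>{1..length vs}. SUP v\<in>verts G.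
            (let P = ?P (set (take (length vs - i) vs))
             in enat (card (parts_meeting (flip_ball G P \<infinity> v) P))) |vs. distinct vs \<and> set vs = verts G}"
      by blast
  qed
qed

end

subsection \<open>The equivalences\<close>

text \<open>Members of a laminar family are nonempty, so the graph without vertices falls outside
  the locale and is treated directly.\<close>

lemma widths_empty:
  assumes "verts G = {}"
  shows "mw \<infinity> G = 0" "tmw \<infinity> G = 0" "dmw \<infinity> G = 0"
proof -
  have chain: "partition_chain (verts G) 1 (\<lambda>_. {})"
    using assms by (simp add: partition_chain_def partition_on_empty)
  have "merge_sequence G 1 (\<lambda>_. {}) (\<lambda>_. {})"
    using chain unfolding merge_sequence_def homogeneous_mod_def by simp
  then have "mw \<infinity> G \<le> merge_sequence_width \<infinity> G 1 (\<lambda>_. {}) (\<lambda>_. {})"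
    unfolding mw_def by (intro Inf_lower) blast
  then show "mw \<infinity> G = 0"
    by (simp add: merge_sequence_width_def bot_enat_def)
  have "flip_by G {} \<in> flips G {}"
    unfolding flips_def by blast
  then have "\<exists>m P H. partition_chain (verts G) m P \<and> (\<forall>i\<in>{1..m}. H i \<in> flips G (P i)) \<and>
      (\<forall>i\<in>{1..<m}. \<forall>v\<in>verts G. card (parts_meeting (graph_ball (H (i + 1)) \<infinity> v) (P i)) \<le> 0)"
    using chain assms
    by (intro exI[of _ "1::nat"] exI[of _ "\<lambda>_. {}"] exI[of _ "\<lambda>_. flip_by G {}"]) simp
  then have "tmw \<infinity> G \<le> enat 0"
    unfolding tmw_def by (intro Inf_lower) blast
  then show "tmw \<infinity> G = 0"
    by (simp flip: zero_enat_def)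
  have "dmw \<infinity> G \<le> (SUP i\<in>{1..length ([] :: 'a list)}. SUP v\<in>verts G.
      (let P = atomic_type_partition G (set (take (length ([] :: 'a list) - i) []))
       in enat (card (parts_meeting (flip_ball G P \<infinity> v) P))))"
    unfolding dmw_def using assms by (intro Inf_lower CollectI exI[of _ "[]"]) auto
  then show "dmw \<infinity> G = 0"
    by (simp add: bot_enat_def)
qed

lemma widths_le_of_clique_width:
  assumes G: "simple_graph G" and "clique_width G \<le> enat K"
  shows "\<exists>k\<le>K. mw \<infinity> G \<le> enat (2 * k) \<and> tmw \<infinity> G \<le> enat (2 * k) \<and> dmw \<infinity> G \<le> enat (type_bound k)"
proof (cases "verts G = {}")
  case True
  then show ?thesis
    using widths_empty[OF True] by auto
next
  case False
  obtain k l where k: "k \<le> K" "cw_constructible k G l"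
  proof -
    obtain x where x: "x \<in> {enat k |k. verts G = {} \<or> (\<exists>l. cw_constructible k G l)}" "x \<le> enat K"
      using assms(2) unfolding clique_width_def by (elim Inf_le_enatE)
    then obtain k l where "x = enat k" "cw_constructible k G l"
      using False by blast
    then show ?thesis
      using that x(2) by simp
  qed
  obtain F where "cut_decomposition G F k"
    by (rule cut_decomposition_exists[OF G k(2)])
  then interpret cut_decomposition G F k .
  show ?thesis
    using k(1) mw_le tmw_le dmw_le by blast
qed

lemma SUP_enat_less_infinity_iff:
  "(SUP x\<in>A. f x :: enat) < \<infinity> \<longleftrightarrow> (\<exists>n. \<forall>x\<in>A. f x \<le> enat n)"
proof
  assume "(SUP x\<in>A. f x) < \<infinity>"
  then obtain n where "(SUP x\<in>A. f x) = enat n"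
    by (cases "SUP x\<in>A. f x") auto
  then show "\<exists>n. \<forall>x\<in>A. f x \<le> enat n"
    by (metis SUP_upper)
next
  assume "\<exists>n. \<forall>x\<in>A. f x \<le> enat n"
  then obtain n where "(SUP x\<in>A. f x) \<le> enat n"
    by (auto simp: SUP_le_iff)
  then show "(SUP x\<in>A. f x) < \<infinity>"
    by (rule le_less_trans) simp
qed

lemma type_bound_mono:
  assumes "j \<le> k"
  shows "type_bound j \<le> type_bound k"
proof -
  have p: "(2::nat) ^ j \<le> 2 ^ k"
    using assms by simp
  have cost: "cut_cost j \<le> cut_cost k"
    unfolding cut_cost_def by (intro mult_le_mono2 add_mono assms p)
  have pt: "piece_types j \<le> piece_types k"
    unfolding piece_types_def by (intro mult_le_mono assms p)
  have r: "resolver_size j \<le> resolver_size k"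
    unfolding resolver_size_def by (intro mult_le_mono pt cost order_refl)
  have st: "step_size j \<le> step_size k"
    using r unfolding step_size_def by (intro add_mono mult_le_mono power_increasing) auto
  show ?thesis
    unfolding type_bound_def Let_def using r st pt
    by (intro add_mono mult_le_mono power_increasing) auto
qed

text \<open>Clique-width bounds \<open>mw\<close>, \<open>tmw\<close> and \<open>dmw\<close>;
  \<open>mw\<close> and \<open>pmw\<close> bound clique-width; \<open>tmw\<close> and, on nonempty
  graphs, \<open>dmw\<close> bound \<open>pmw\<close>. The passage from clique-width to
  \<open>pmw\<close> goes through \<open>tmw\<close>.\<close>

theorem theorem1p2:
  fixes C :: "'a ugraph set"
  assumes "\<forall>G\<in>C. simple_graph G"
  shows "((SUP G\<in>C. clique_width G) < \<infinity> \<longleftrightarrow> (SUP G\<in>C. mw \<infinity> G) < \<infinity>) \<and>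
         ((SUP G\<in>C. clique_width G) < \<infinity> \<longleftrightarrow> (SUP G\<in>C. tmw \<infinity> G) < \<infinity>) \<and>
         ((SUP G\<in>C. clique_width G) < \<infinity> \<longleftrightarrow> (SUP G\<in>C. pmw \<infinity> G) < \<infinity>) \<and>
         ((SUP G\<in>C. clique_width G) < \<infinity> \<longleftrightarrow> (SUP G\<in>C. dmw \<infinity> G) < \<infinity>)"
proof -
  have fin: "finite (verts G)" if "G \<in> C" for G
    using assms that unfolding simple_graph_def by blast
  let ?bounded = "\<lambda>f. \<exists>n. \<forall>G\<in>C. f G \<le> enat n"
  have cw_imp: "?bounded (mw \<infinity>) \<and> ?bounded (tmw \<infinity>) \<and> ?bounded (dmw \<infinity>)" if cw: "?bounded clique_width"
  proof -
    obtain K where K: "\<forall>G\<in>C. clique_width G \<le> enat K"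
      using cw by blast
    have "mw \<infinity> G \<le> enat (2 * K) \<and> tmw \<infinity> G \<le> enat (2 * K) \<and> dmw \<infinity> G \<le> enat (type_bound K)"
      if GC: "G \<in> C" for G
    proof -
      obtain k where k: "k \<le> K" "mw \<infinity> G \<le> enat (2 * k)" "tmw \<infinity> G \<le> enat (2 * k)"
        "dmw \<infinity> G \<le> enat (type_bound k)"
        using widths_le_of_clique_width[of G K] assms K GC by blast
      moreover have "enat (2 * k) \<le> enat (2 * K)" "enat (type_bound k) \<le> enat (type_bound K)"
        using k(1) type_bound_mono by simp_all
      ultimately show ?thesis
        using order_trans by blast
    qed
    then show ?thesis
      by blast
  qed
  have mw_imp: "?bounded clique_width" if "?bounded (mw \<infinity>)"
    using that clique_width_le_mw assms by meson
  have pmw_imp: "?bounded clique_width" if "?bounded (pmw \<infinity>)"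
    using that clique_width_le_pmw assms by meson
  have tmw_imp: "?bounded (pmw \<infinity>)" if "?bounded (tmw \<infinity>)"
    using that pmw_le_tmw fin by meson
  have dmw_imp: "?bounded clique_width" if dmw: "?bounded (dmw \<infinity>)"
  proof -
    obtain k where k: "\<forall>G\<in>C. dmw \<infinity> G \<le> enat k"
      using dmw by blast
    have "clique_width G \<le> enat (2 * Suc (4 * k))" if GC: "G \<in> C" for G
    proof (cases "verts G = {}")
      case True
      then show ?thesis
        by (simp add: clique_width_empty)
    next
      case False
      then show ?thesis
        using clique_width_le_pmw pmw_le_dmw assms k GC by blast
    qed
    then show ?thesis
      by blast
  qed
  show ?thesis
    unfolding SUP_enat_less_infinity_iff
    using cw_imp mw_imp pmw_imp tmw_imp dmw_imp by argo
qed

end
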